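(* Let $U_L,U_R>0$, $\mu_L,\mu_R\ge 0$ with $\mu_L+\mu_R>0$, and let initial and final configurations $(x_i,y_i,\alpha_i)$ and $(x_f,y_f,\alpha_f)$ be given. If the weighted Markov-Dubins problem with these data has an optimal path, then it has an optimal path whose type is one of the following $21$ words: (1 segment) $S, L, R$; (2 segments) $SL, SR, LS, RS, LR, RL$; (3 segments) $LSL, LSR, RSL, RSR, SLS, SRS$; (4 segments) $LSRS, SRSL, RSLS, SLSR$; (5 segments) $LSRSL, RSLSR$.
   Context: Weighted Markov-Dubins problem: fix $U_L,U_R>0$, $r_L=1/U_L$, $r_R=1/U_R$, and penalties $\mu_L,\mu_R\ge0$ with $\mu_L+\mu_R>0$. Given configurations $(x_i,y_i,\alpha_i)$, $(x_f,y_f,\alpha_f)$ (headings are angles, identified modulo $2\pi$), minimize, over free final time $t_f$ and measurable controls $(u_L,u_R):[0,t_f]\to[0,U_L]\times[0,U_R]$, the cost $\int_0^{t_f}(1+\mu_Lu_L(t)+\mu_Ru_R(t))\,dt$ subject to $\dot x=\cos\alpha$, $\dot y=\sin\alpha$, $\dot\alpha=u_L-u_R$, $(x,y,\alpha)(0)=(x_i,y_i,\alpha_i)$, $(x,y,\alpha)(t_f)=(x_f,y_f,\alpha_f)$. An optimal path is a minimizer. Segments: an $L$ segment is a piece of path on a time interval where $(u_L,u_R)=(U_L,0)$ a.e. (left-turn arc of a circle of radius $r_L$); an $R$ segment is one where $(u_L,u_R)=(0,U_R)$ a.e. (right-turn arc of radius $r_R$); an $S$ segment is one where $(u_L,u_R)=(0,0)$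 a.e. (straight line segment). A path is of type $X_1X_2\cdots X_n$ with $X_j\in\{L,R,S\}$, $X_j\neq X_{j+1}$, if it is the concatenation, in this order, of segments of these kinds, all of positive length. When the initial and final configurations coincide, the path with $t_f=0$ is regarded as a (degenerate) path of type $S$ with length zero. *)

theory Defs
  imports "HOL-Analysis.Analysis" "HOL-Library.Real_Mod"
begin

text \<open>
  A path is a final time together with the controls and the state trajectory; only the values on
  \<open>{0..final_time}\<close> matter. The heading is a real-valued lift of the angle.
\<close>

record path_data =
  final_time :: real
  control_L :: "real \<Rightarrow> real"
  control_R :: "real \<Rightarrow> real"
  pos_x :: "real \<Rightarrow> real"
  pos_y :: "real \<Rightarrow> real"
  heading :: "real \<Rightarrow> real"

type_synonym configuration = "real \<times> real \<times> real"

definition controls_in :: "real \<Rightarrow> real \<Rightarrow> path_data \<Rightarrow> bool" where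
  "controls_in U_L U_R p \<longleftrightarrow>
     control_L p \<in> borel_measurable (lebesgue_on {0..final_time p}) \<and>
     control_R p \<in> borel_measurable (lebesgue_on {0..final_time p}) \<and>
     (\<forall>t\<in>{0..final_time p}. control_L p t \<in> {0..U_L} \<and> control_R p t \<in> {0..U_R})"

text \<open>
  As the controls are merely measurable, the differential equations are understood in the sense of
  Caratheodory, i.e. in integrated form. All integrands below are measurable and bounded on
  compact intervals, so the gauge integral agrees with the Lebesgue integral.
\<close>

definition satisfies_dynamics :: "path_data \<Rightarrow> bool" where
  "satisfies_dynamics p \<longleftrightarrow>
     (\<forall>t\<in>{0..final_time p}.
        ((\<lambda>s. cos (heading p s)) has_integral (pos_x p t - pos_x p 0)) {0..t} \<and>
        ((\<lambda>s. sin (heading p s)) has_integral (pos_y p t - pos_y p 0)) {0..t} \<and>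
        ((\<lambda>s. control_L p s - control_R p s) has_integral (heading p t - heading p 0)) {0..t})"

definition at_configuration :: "path_data \<Rightarrow> real \<Rightarrow> configuration \<Rightarrow> bool" where
  "at_configuration p t c \<longleftrightarrow>
     (case c of (x, y, \<alpha>) \<Rightarrow>
        pos_x p t = x \<and> pos_y p t = y \<and> [heading p t = \<alpha>] (rmod (2 * pi)))"

definition admissible ::
    "real \<Rightarrow> real \<Rightarrow> configuration \<Rightarrow> configuration \<Rightarrow> path_data \<Rightarrow> bool" where
  "admissible U_L U_R c_i c_f p \<longleftrightarrow>
     final_time p \<ge> 0 \<and> controls_in U_L U_R p \<and> satisfies_dynamics p \<and>
     at_configuration p 0 c_i \<and> at_configuration p (final_time p) c_f"

definition cost :: "real \<Rightarrow> real \<Rightarrow> path_data \<Rightarrow> real" where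
  "cost \<mu>_L \<mu>_R p =
     integral {0..final_time p} (\<lambda>t. 1 + \<mu>_L * control_L p t + \<mu>_R * control_R p t)"

definition optimal ::
    "real \<Rightarrow> real \<Rightarrow> real \<Rightarrow> real \<Rightarrow> configuration \<Rightarrow> configuration \<Rightarrow> path_data \<Rightarrow> bool" where
  "optimal U_L U_R \<mu>_L \<mu>_R c_i c_f p \<longleftrightarrow>
     admissible U_L U_R c_i c_f p \<and>
     (\<forall>q. admissible U_L U_R c_i c_f q \<longrightarrow> cost \<mu>_L \<mu>_R p \<le> cost \<mu>_L \<mu>_R q)"

datatype segment = L | R | S

fun segment_controls :: "real \<Rightarrow> real \<Rightarrow> segment \<Rightarrow> real \<times> real" where
  "segment_controls U_L U_R L = (U_L, 0)"
| "segment_controls U_L U_R R = (0, U_R)"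
| "segment_controls U_L U_R S = (0, 0)"

definition is_segment_on ::
    "real \<Rightarrow> real \<Rightarrow> path_data \<Rightarrow> segment \<Rightarrow> real \<Rightarrow> real \<Rightarrow> bool" where
  "is_segment_on U_L U_R p X a b \<longleftrightarrow>
     (AE t in lebesgue. t \<in> {a..b} \<longrightarrow>
        (control_L p t, control_R p t) = segment_controls U_L U_R X)"

text \<open>
  The second disjunct is the degenerate case: an admissible path with final time zero, which exists
  only if the initial and final configurations coincide, counts as a path of type \<open>S\<close>. All paths
  have unit speed, so a segment has positive length iff its time interval does.
\<close>

definition of_type :: "real \<Rightarrow> real \<Rightarrow> path_data \<Rightarrow> segment list \<Rightarrow> bool" where
  "of_type U_L U_R p w \<longleftrightarrow>
     w \<noteq> [] \<and> distinct_adj w \<and>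
     (\<exists>\<tau> :: nat \<Rightarrow> real. \<tau> 0 = 0 \<and> \<tau> (length w) = final_time p \<and>
        (\<forall>j < length w. \<tau> j < \<tau> (Suc j) \<and>
           is_segment_on U_L U_R p (w ! j) (\<tau> j) (\<tau> (Suc j))))
     \<or> final_time p = 0 \<and> w = [S]"

end

theory Submission
  imports Defs
begin

text \<open>
  Let the final heading be at least the initial one, the other case following by reflection. If the headings
  of a path range over \<open>[a, b]\<close>, then the path has to sweep the headings from the initial one down to
  \<open>a\<close>, up to \<open>b\<close> and down to the final one, or in the opposite order, which costs more. What remains of
  the motion after subtracting these sweeps at maximal rate is a nonnegative measure on \<open>[a, b]\<close> that records
  how long the path moves straight in each direction, so it can be rearranged without changing the end points,
  and its total mass is minimized by at most two directions: either a single one, or \<open>a\<close> and \<open>b\<close>. The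
  existence of the measure itself is not needed, only its pairing with nonnegative functions
  \<open>c - n\<^sub>1 cos \<beta> - n\<^sub>2 sin \<beta>\<close> on \<open>[a, b]\<close>.

  Hence some optimal path is of type \<open>RSLSR\<close> with straight pieces at \<open>a\<close> and \<open>b\<close>, or of type
  \<open>RLSLR\<close>, up to empty segments. In the latter case one improves the path by shrinking \<open>[a, b]\<close> and
  replacing the pair of opposite arcs that is cut off by slightly cheaper straight pieces, unless an outer \<open>R\<close>
  is empty and, if the other one is not, the straight piece sits at the extreme heading next to it.
\<close>

subsection \<open>The finite-dimensional problem\<close>

text \<open>The integral of \<^term>\<open>cis\<close> from \<open>a\<close> to \<open>b\<close>, i.e. the displacement along a left arc of radius 1.\<close>

definition chord :: "real \<Rightarrow> real \<Rightarrow> complex" where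
  "chord a b = \<i> * (cis a - cis b)"

lemma Re_chord [simp]: "Re (chord a b) = sin b - sin a"
  and Im_chord [simp]: "Im (chord a b) = cos a - cos b"
  by (simp_all add: chord_def)

text \<open>A pair \<open>(\<beta>, s)\<close> stands for a straight piece of length \<open>s\<close> with heading \<open>\<beta>\<close>.\<close>

definition atoms :: "(real \<times> real) list \<Rightarrow> complex" where
  "atoms xs = (\<Sum>(\<beta>, s)\<leftarrow>xs. complex_of_real s * cis \<beta>)"

definition mass :: "(real \<times> real) list \<Rightarrow> real" where
  "mass xs = (\<Sum>(\<beta>, s)\<leftarrow>xs. s)"

lemma atoms_simps [simp]:
  "atoms [] = 0" "atoms ((\<beta>, s) # xs) = complex_of_real s * cis \<beta> + atoms xs"
  by (simp_all add: atoms_def)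

lemma mass_simps [simp]: "mass [] = 0" "mass ((\<beta>, s) # xs) = s + mass xs"
  by (simp_all add: mass_def)

text \<open>
  \<open>[lo, hi]\<close> is spanned by the initial and final heading, \<open>[a, b]\<close> is the range of all headings, and
  \<open>K\<close> is the sum of the two radii, since headings outside \<open>[lo, hi]\<close> are swept once by a left and once
  by a right arc. Both \<open>W\<close> and the excess leave out the contribution of the obligatory sweep of \<open>[lo, hi]\<close>.
\<close>

definition feasible ::
    "real \<Rightarrow> complex \<Rightarrow> real \<Rightarrow> real \<Rightarrow> real \<Rightarrow> real \<Rightarrow> (real \<times> real) list \<Rightarrow> bool" where
  "feasible K W lo hi a b xs \<longleftrightarrow>
     a \<le> lo \<and> hi \<le> b \<and> (\<forall>(\<beta>, s) \<in> set xs. a \<le> \<beta> \<and> \<beta> \<le> b \<and> 0 \<le> s) \<and>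
     complex_of_real K * (chord a lo + chord hi b) + atoms xs = W"

definition excess ::
    "real \<Rightarrow> real \<Rightarrow> real \<Rightarrow> real \<Rightarrow> real \<Rightarrow> real \<Rightarrow> (real \<times> real) list \<Rightarrow> real" where
  "excess K M lo hi a b xs = (K + M) * ((lo - a) + (b - hi)) + mass xs"

definition minimal ::
    "real \<Rightarrow> real \<Rightarrow> complex \<Rightarrow> real \<Rightarrow> real \<Rightarrow> real \<Rightarrow> real \<Rightarrow> (real \<times> real) list \<Rightarrow> bool" where
  "minimal K M W lo hi a b xs \<longleftrightarrow>
     feasible K W lo hi a b xs \<and>
     (\<forall>a' b' ys. feasible K W lo hi a' b' ys \<longrightarrow>
        excess K M lo hi a b xs \<le> excess K M lo hi a' b' ys)"

lemma minimal_eqI: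
  assumes "minimal K M W lo hi a b xs" "feasible K W lo hi a' b' ys"
    "excess K M lo hi a' b' ys \<le> excess K M lo hi a b xs"
  shows "minimal K M W lo hi a' b' ys"
  using assms unfolding minimal_def by (meson order_trans)

section \<open>Mirror symmetry, exchanging the two ends of the heading range\<close>

definition mirror :: "(real \<times> real) list \<Rightarrow> (real \<times> real) list" where
  "mirror xs = map (\<lambda>(\<beta>, s). (- \<beta>, s)) xs"

lemma mirror_simps [simp]:
  "mirror [] = []" "mirror ((\<beta>, s) # xs) = (- \<beta>, s) # mirror xs"
  "mirror (mirror xs) = xs" "mass (mirror xs) = mass xs" "atoms (mirror xs) = cnj (atoms xs)"
proof -
  show "mirror [] = []" "mirror ((\<beta>, s) # xs) = (- \<beta>, s) # mirror xs"
    by (simp_all add: mirror_def)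
  show "mirror (mirror xs) = xs"
    by (induction xs) (auto simp: mirror_def)
  show "mass (mirror xs) = mass xs"
    by (induction xs) (auto simp: mirror_def)
  show "atoms (mirror xs) = cnj (atoms xs)"
    by (induction xs) (auto simp: mirror_def cis_cnj)
qed

lemma feasible_mirror:
  assumes "feasible K W lo hi a b xs"
  shows "feasible K (cnj W) (- hi) (- lo) (- b) (- a) (mirror xs)"
proof -
  have "chord (- b) (- hi) + chord (- lo) (- a) = cnj (chord a lo + chord hi b)"
    by (simp add: complex_eq_iff)
  moreover have "cnj (complex_of_real K * (chord a lo + chord hi b) + atoms xs) = cnj W"
    using assms by (simp add: feasible_def)
  ultimately show ?thesis
    using assms by (auto simp: feasible_def mirror_def[of xs] simp flip: mirror_simps(5))
qed

lemma excess_mirror [simp]: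
  "excess K M (- hi) (- lo) (- b) (- a) (mirror xs) = excess K M lo hi a b xs"
  by (simp add: excess_def algebra_simps)

lemma minimal_mirror:
  assumes "minimal K M W lo hi a b xs"
  shows "minimal K M (cnj W) (- hi) (- lo) (- b) (- a) (mirror xs)"
  unfolding minimal_def
proof (intro conjI allI impI)
  show "feasible K (cnj W) (- hi) (- lo) (- b) (- a) (mirror xs)"
    using assms feasible_mirror unfolding minimal_def by blast
next
  fix a' b' ys
  assume "feasible K (cnj W) (- hi) (- lo) a' b' ys"
  from feasible_mirror[OF this] have "feasible K W lo hi (- b') (- a') (mirror ys)"
    by simp
  then have "excess K M lo hi a b xs \<le> excess K M lo hi (- b') (- a') (mirror ys)"
    using assms unfolding minimal_def by blast
  also have "\<dots> = excess K M (- hi) (- lo) a' b' ys"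
    by (simp add: excess_def algebra_simps)
  finally show "excess K M (- hi) (- lo) (- b) (- a) (mirror xs) \<le> excess K M (- hi) (- lo) a' b' ys"
    by simp
qed

section \<open>Decomposition of chords into straight directions, and trigonometric bounds\<close>

lemma chord_split: "chord a c = chord a b + chord b c"
  by (simp add: chord_def algebra_simps)

text \<open>Dividing by \<open>cis (a + e)\<close> leaves a real 2x2 linear system for the
  directions 1 and \<open>cis \<delta>\<close>. The sign of \<open>sin \<delta>\<close> decides that
  of the second coefficient: nonpositive for \<delta> in (0, pi), so that an existing straight piece
  has to be shortened, and nonnegative for \<delta> in (pi, 2 pi).\<close>

lemma chord_as_two_directions:
  assumes "sin \<delta> \<noteq> 0"
  shows "chord a (a + e) =
    complex_of_real ((cos \<delta> - cos (\<delta> + e)) / sin \<delta>) * cis (a + e) +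
    complex_of_real (- ((1 - cos e) / sin \<delta>)) * cis (a + e + \<delta>)"
proof -
  have "\<i> * (cis (- e) - 1) =
      complex_of_real ((cos \<delta> - cos (\<delta> + e)) / sin \<delta>) +
      complex_of_real (- ((1 - cos e) / sin \<delta>)) * cis \<delta>"
    using assms by (simp add: complex_eq_iff cos_add field_simps)
  then have "cis (a + e) * (\<i> * (cis (- e) - 1)) = cis (a + e) * (
      complex_of_real ((cos \<delta> - cos (\<delta> + e)) / sin \<delta>) +
      complex_of_real (- ((1 - cos e) / sin \<delta>)) * cis \<delta>)"
    by simp
  moreover have "cis (a + e) * (\<i> * (cis (- e) - 1)) = chord a (a + e)"
    by (simp add: chord_def algebra_simps cis_mult)
  moreover have "cis (a + e) * cis \<delta> = cis (a + e + \<delta>)"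
    by (simp add: cis_mult)
  moreover have "z * (x + y * w) = x * z + y * (z * w)" for x y z w :: complex
    by (simp add: algebra_simps)
  ultimately show ?thesis
    by metis
qed

text \<open>The signed length of the two replacing pieces is e to first order; the sign of
  \<open>sin \<delta>\<close> decides whether the second-order term helps or hurts.\<close>

lemma coefficient_sum:
  fixes \<delta> e :: real
  assumes "sin \<delta> \<noteq> 0"
  shows "(cos \<delta> - cos (\<delta> + e)) / sin \<delta> - (1 - cos e) / sin \<delta> =
    sin e - (1 - cos \<delta>) * (1 - cos e) / sin \<delta>"
proof -
  have "cos \<delta> - cos (\<delta> + e) - (1 - cos e) = sin \<delta> * sin e - (1 - cos \<delta>) * (1 - cos e)"
    using cos_add[of \<delta> e] by (simp add: algebra_simps)
  then show ?thesis
    using assms by (simp add: diff_divide_distrib[symmetric] divide_simps)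
qed

lemma abs_sin_diff_le: "\<bar>sin x - sin y\<bar> \<le> \<bar>x - y\<bar>" for x y :: real
proof -
  have "\<bar>sin x - sin y\<bar> = 2 * \<bar>sin ((x - y) / 2)\<bar> * \<bar>cos ((x + y) / 2)\<bar>"
    by (simp add: sin_diff_sin abs_mult)
  also have "\<dots> \<le> 2 * \<bar>(x - y) / 2\<bar> * 1"
    by (intro mult_mono abs_sin_x_le_abs_x) auto
  finally show ?thesis by simp
qed

lemma abs_cos_diff_le: "\<bar>cos x - cos y\<bar> \<le> \<bar>x - y\<bar>" for x y :: real
  using abs_sin_diff_le[of "pi / 2 - x" "pi / 2 - y"] by (simp add: cos_sin_eq abs_minus_commute)

lemma one_minus_cos_le: "1 - cos (x::real) \<le> x\<^sup>2 / 2"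
proof -
  have "1 - cos x = 2 * sin (x / 2) ^ 2"
    using cos_double_sin[of "x / 2"] by simp
  also have "sin (x / 2) ^ 2 \<le> (x / 2) ^ 2"
    by (metis abs_sin_x_le_abs_x power2_le_iff_abs_le abs_ge_zero power2_abs)
  finally show ?thesis by (simp add: power2_eq_square)
qed

section \<open>Perturbations that shrink the heading range\<close>

lemma shrink_feasible:
  assumes "feasible K W lo hi a b xs" and "a + e \<le> lo" "0 \<le> e" "a + e \<le> b"
    and "atoms ys = atoms xs + complex_of_real K * chord a (a + e)"
    and "\<And>\<beta> s. (\<beta>, s) \<in> set ys \<Longrightarrow> a + e \<le> \<beta> \<and> \<beta> \<le> b \<and> 0 \<le> s"
  shows "feasible K W lo hi (a + e) b ys"
  using assms chord_split[of a lo "a + e"] by (auto simp: feasible_def algebra_simps)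

lemma excess_shrink:
  "excess K M lo hi (a + e) b ys = excess K M lo hi a b xs - (K + M) * e + (mass ys - mass xs)"
  by (simp add: excess_def algebra_simps)

text \<open>
  In the perturbation lemmas the overshoot \<open>[a, a + e]\<close> is dropped, which saves \<open>(K + M) e\<close>, and the lost
  displacement is made up for by straight pieces of total length at most \<open>K e + O(e\<^sup>2)\<close>.
\<close>

lemma not_minimal_atom_inside:
  assumes K: "K > 0" and M: "M > 0" and le: "lo \<le> hi"
    and min: "minimal K M W lo hi a b [(\<beta>, s)]"
    and "a < lo" "a < \<beta>" "\<beta> \<le> a + pi" "s > 0"
  shows False
proof -
  define \<theta> where "\<theta> = \<beta> - a"
  have \<theta>: "0 < \<theta>" "\<theta> \<le> pi" using assms by (auto simp: \<theta>_def)
  have feas: "feasible K W lo hi a b [(\<beta>, s)]"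
    using min by (simp add: minimal_def)
  \<comment> \<open>With \<delta> = \<theta> - e this is \<open>K * c2 \<le> s\<close> for the
    coefficient \<open>c2\<close> below: the piece at \<beta> is long enough to be
    shortened.\<close>
  have ev: "\<forall>\<^sub>F e in at_right 0. K * (1 - cos e) \<le> s * sin (\<theta> - e)"
  proof (cases "\<theta> = pi")
    case True
    \<comment> \<open>For \<theta> = pi both sides tend to 0, so first-order terms are compared: the
      difference has slope s > 0.\<close>
    have "((\<lambda>e. s * sin (\<theta> - e) - K * (1 - cos e)) has_real_derivative s) (at 0)"
      using True by (auto intro!: derivative_eq_intros)
    from DERIV_pos_inc_right[OF this \<open>s > 0\<close>] obtain d where
      "d > 0" "\<And>e. 0 < e \<Longrightarrow> e < d \<Longrightarrow> 0 < s * sin (\<theta> - e) - K * (1 - cos e)"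
      using True by auto
    then show ?thesis
      by (intro eventually_at_rightI[of 0 d]) (auto simp: less_imp_le algebra_simps)
  next
    case False
    have lim: "((\<lambda>e. s * sin (\<theta> - e) - K * (1 - cos e)) \<longlongrightarrow> s * sin (\<theta> - 0) - K * (1 - cos 0)) (at_right 0)"
      by (intro tendsto_intros)
    moreover have "sin \<theta> > 0" using \<theta> False by (intro sin_gt_zero) auto
    ultimately have "\<forall>\<^sub>F e in at_right 0. s * sin (\<theta> - e) - K * (1 - cos e) > 0"
      using \<open>s > 0\<close> by (intro order_tendstoD(1)[OF lim]) auto
    then show ?thesis by eventually_elim simp
  qed
  moreover have "\<forall>\<^sub>F e in at_right 0. 0 < e \<and> e < min \<theta> (lo - a)"
    using \<theta> \<open>a < lo\<close> by (intro eventually_at_rightI[of 0 "min \<theta> (lo - a)"]) auto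
  ultimately have "\<forall>\<^sub>F e in at_right 0. K * (1 - cos e) \<le> s * sin (\<theta> - e) \<and> 0 < e \<and> e < min \<theta> (lo - a)"
    by eventually_elim auto
  then obtain e where e: "K * (1 - cos e) \<le> s * sin (\<theta> - e)" "0 < e" "e < \<theta>" "e < lo - a"
    using eventually_happens by (metis (no_types, lifting) min_less_iff_conj trivial_limit_at_right_real)
  define \<delta> where "\<delta> = \<theta> - e"
  have sd: "sin \<delta> > 0"
    using e \<theta> by (intro sin_gt_zero) (auto simp: \<delta>_def)
  define c1 where "c1 = (cos \<delta> - cos (\<delta> + e)) / sin \<delta>"
  define c2 where "c2 = (1 - cos e) / sin \<delta>"
  have c1: "c1 \<ge> 0"
    using sd e \<theta> unfolding c1_def \<delta>_def by (intro divide_nonneg_pos) (auto intro!: cos_monotone_0_pi_le)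
  have c2: "K * c2 \<le> s" using e(1) sd by (simp add: c2_def \<delta>_def field_simps)
  have "c1 - c2 = sin e - (1 - cos \<delta>) * (1 - cos e) / sin \<delta>"
    using coefficient_sum[of \<delta> e] sd by (simp add: c1_def c2_def)
  also have "\<dots> \<le> sin e" using sd by simp
  also have "\<dots> \<le> e" using e by (simp add: sin_x_le_x)
  finally have c12: "K * (c1 - c2) \<le> K * e" using K by simp
  \<comment> \<open>The piece at \<beta> gives up \<open>K * c2\<close> while one of length
    \<open>K * c1\<close> appears at the new end \<open>a + e\<close>. The net length grows by at
    most \<open>K * e\<close>, which leaves a gain of \<open>M * e\<close>.\<close>
  define ys where "ys = [(a + e, K * c1), (\<beta>, s - K * c2)]"
  have \<beta>: "a + e + \<delta> = \<beta>" by (simp add: \<delta>_def \<theta>_def)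
  have "chord a (a + e) = complex_of_real c1 * cis (a + e) - complex_of_real c2 * cis \<beta>"
    using chord_as_two_directions[of \<delta> a e] sd unfolding c1_def c2_def \<beta> by simp
  then have "atoms ys = atoms [(\<beta>, s)] + complex_of_real K * chord a (a + e)"
    by (simp only: ys_def atoms_simps) (simp add: algebra_simps)
  then have "feasible K W lo hi (a + e) b ys"
    using feas e c1 c2 K le \<beta> unfolding \<delta>_def ys_def
    by (intro shrink_feasible[where xs="[(\<beta>, s)]"]) (auto simp: feasible_def \<theta>_def)
  then have "excess K M lo hi a b [(\<beta>, s)] \<le> excess K M lo hi (a + e) b ys"
    using min by (auto simp: minimal_def)
  moreover have "M * e > 0" using M e by simp
  ultimately show False
    using c12 unfolding excess_shrink[of K M lo hi a e b ys "[(\<beta>, s)]"]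
    by (simp add: ys_def algebra_simps)
qed

text \<open>A range wider than pi contains a heading \<open>b'\<close> more than pi above
  \<open>a\<close>. Then both coefficients of the decomposition are nonnegative: the arcs cut off
  are replaced by two new pieces, and the old piece, not being at \<open>a\<close>, stays as it is.
  The added length is \<open>K * e + O(e^2)\<close>, against a saving of
  \<open>(K + M) * e\<close>.\<close>

lemma not_minimal_wide:
  assumes K: "K > 0" and M: "M > 0" and le: "lo \<le> hi"
    and min: "minimal K M W lo hi a b [(\<beta>, s)]"
    and "a < lo" "a < \<beta>" "a + pi < b"
  shows False
proof -
  have feas: "feasible K W lo hi a b [(\<beta>, s)]"
    using min by (simp add: minimal_def)
  \<comment> \<open>The cap keeps \<theta> strictly between pi and 2 pi, where the sine is negative,
    however large \<open>b\<close> is.\<close>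
  define b' where "b' = min b (a + 3 * pi / 2)"
  define \<theta> where "\<theta> = b' - a"
  have \<theta>: "pi < \<theta>" "\<theta> < 2 * pi" using assms pi_gt_zero by (auto simp: \<theta>_def b'_def min_def)
  \<comment> \<open>The inequality obtained from this limit,
    \<open>K * e < M * (- sin (\<theta> - e))\<close>, makes the quadratic error
    \<open>K * e\<^sup>2 / (- sin \<delta>)\<close> smaller than \<open>M * e\<close>.\<close>
  have lim: "((\<lambda>e. - M * sin (\<theta> - e) - K * e) \<longlongrightarrow> - M * sin (\<theta> - 0) - K * 0) (at_right 0)"
    by (intro tendsto_intros)
  moreover have "sin \<theta> < 0" using \<theta> by (intro sin_lt_zero) auto
  ultimately have "\<forall>\<^sub>F e in at_right 0. - M * sin (\<theta> - e) - K * e > 0"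
    using M by (intro order_tendstoD(1)[OF lim]) (auto simp: mult_pos_neg)
  moreover have "\<forall>\<^sub>F e in at_right 0. 0 < e \<and> e < min (min (\<theta> - pi) (\<beta> - a)) (lo - a)"
    using \<theta> \<open>a < lo\<close> \<open>a < \<beta>\<close>
    by (intro eventually_at_rightI[of 0 "min (min (\<theta> - pi) (\<beta> - a)) (lo - a)"]) auto
  ultimately have "\<forall>\<^sub>F e in at_right 0. K * e < M * (- sin (\<theta> - e)) \<and>
      0 < e \<and> e < min (min (\<theta> - pi) (\<beta> - a)) (lo - a)"
    by eventually_elim auto
  then obtain e where e: "K * e < M * (- sin (\<theta> - e))" "0 < e" "e < \<theta> - pi" "e < \<beta> - a" "e < lo - a"
    using eventually_happens by (metis (no_types, lifting) min_less_iff_conj trivial_limit_at_right_real)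
  define \<delta> where "\<delta> = \<theta> - e"
  have sd: "sin \<delta> < 0"
    using e \<theta> by (intro sin_lt_zero) (auto simp: \<delta>_def)
  define c1 where "c1 = (cos \<delta> - cos (\<delta> + e)) / sin \<delta>"
  define c2 where "c2 = - ((1 - cos e) / sin \<delta>)"
  have "cos (2 * pi - \<delta>) \<le> cos (2 * pi - (\<delta> + e))"
    using e \<theta> by (intro cos_monotone_0_pi_le) (auto simp: \<delta>_def)
  then have "cos \<delta> \<le> cos (\<delta> + e)" by (simp add: cos_diff cos_2pi_minus)
  then have c1: "c1 \<ge> 0"
    using sd unfolding c1_def by (intro divide_nonpos_neg) auto
  have c2: "c2 \<ge> 0" using sd by (simp add: c2_def divide_nonneg_neg)
  have "c1 + c2 = sin e + (1 - cos \<delta>) * (1 - cos e) / (- sin \<delta>)"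
    using coefficient_sum[of \<delta> e] sd by (simp add: c1_def c2_def)
  also have "\<dots> \<le> e + e\<^sup>2 / (- sin \<delta>)"
  proof (intro add_mono divide_right_mono)
    have "(1 - cos \<delta>) * (1 - cos e) \<le> 2 * (e\<^sup>2 / 2)"
      using cos_ge_minus_one[of \<delta>] by (intro mult_mono one_minus_cos_le) auto
    then show "(1 - cos \<delta>) * (1 - cos e) \<le> e\<^sup>2" by simp
  qed (use sd e in \<open>auto simp: sin_x_le_x\<close>)
  finally have "K * (c1 + c2) \<le> K * (e + e\<^sup>2 / (- sin \<delta>))" using K by simp
  also have "K * (e\<^sup>2 / (- sin \<delta>)) < M * e"
  proof -
    have "K * e * e < M * (- sin \<delta>) * e"
      using e by (intro mult_strict_right_mono) (auto simp: \<delta>_def)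
    then show ?thesis using sd by (simp add: field_simps power2_eq_square)
  qed
  then have "K * (e + e\<^sup>2 / (- sin \<delta>)) < (K + M) * e" by (simp add: algebra_simps)
  finally have c12: "K * (c1 + c2) < (K + M) * e" .
  define ys where "ys = [(a + e, K * c1), (b', K * c2), (\<beta>, s)]"
  have b': "a + e + \<delta> = b'" by (simp add: \<delta>_def \<theta>_def)
  have "chord a (a + e) = complex_of_real c1 * cis (a + e) + complex_of_real c2 * cis b'"
    using chord_as_two_directions[of \<delta> a e] sd unfolding c1_def c2_def b' by simp
  then have "atoms ys = atoms [(\<beta>, s)] + complex_of_real K * chord a (a + e)"
    by (simp only: ys_def atoms_simps) (simp add: algebra_simps)
  moreover have "b' \<le> b" by (simp add: b'_def)
  moreover have "a + e \<le> b'" using e pi_gt_zero unfolding \<theta>_def by linarith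
  ultimately have "feasible K W lo hi (a + e) b ys"
    using feas e c1 c2 K le unfolding ys_def
    by (intro shrink_feasible[where xs="[(\<beta>, s)]"]) (auto simp: feasible_def)
  then have "excess K M lo hi a b [(\<beta>, s)] \<le> excess K M lo hi (a + e) b ys"
    using min by (auto simp: minimal_def)
  then show False
    using c12 unfolding excess_shrink[of K M lo hi a e b ys "[(\<beta>, s)]"]
    by (simp add: ys_def algebra_simps)
qed

text \<open>The two end pieces are symmetric about the mean heading, so their components
  perpendicular to it cancel.\<close>

lemma chord_pair:
  "chord a (a + e) + chord (b - e) b =
    complex_of_real (2 * (sin ((b - a) / 2) - sin ((b - a) / 2 - e))) * cis ((a + b) / 2)"
proof -
  define m h where "m = (a + b) / 2" and "h = (b - a) / 2"
  have "chord (m - h) (m - (h - e)) + chord (m + (h - e)) (m + h) =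
      complex_of_real (2 * (sin h - sin (h - e))) * cis m"
    by (simp add: complex_eq_iff sin_add sin_diff[of m] cos_add cos_diff[of m])
      (simp add: algebra_simps)
  moreover have "m - (h - e) = a + e" "m + (h - e) = b - e" "m - h = a" "m + h = b"
    by (simp_all add: m_def h_def field_simps)
  ultimately have "chord a (a + e) + chord (b - e) b =
      complex_of_real (2 * (sin h - sin (h - e))) * cis m"
    by metis
  then show ?thesis
    by (simp only: m_def h_def)
qed

text \<open>With overshoot at both ends and no straight piece, cutting e off each end loses a
  displacement along the mean heading only. A straight piece of length at most
  \<open>2 * K * e\<close> restores it, while \<open>2 * (K + M) * e\<close> is saved. The bound
  \<open>b \<le> a + pi\<close> makes that length nonnegative.\<close>

lemma not_minimal_no_atom:
  assumes K: "K > 0" and M: "M > 0" and le: "lo \<le> hi"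
    and min: "minimal K M W lo hi a b [(\<beta>, 0)]"
    and "a < lo" "hi < b" "b \<le> a + pi"
  shows False
proof -
  have feas: "feasible K W lo hi a b [(\<beta>, 0)]"
    using min by (simp add: minimal_def)
  define e where "e = min (lo - a) (b - hi) / 2"
  have e: "0 < e" "a + e < lo" "hi < b - e"
    using assms by (auto simp: e_def min_def field_simps)
  define c where "c = 2 * (sin ((b - a) / 2) - sin ((b - a) / 2 - e))"
  have "sin ((b - a) / 2 - e) \<le> sin ((b - a) / 2)"
  proof (rule sin_monotone_2pi_le)
    have "e \<le> (b - a) / 2" using e le by (simp add: field_simps)
    then show "- (pi / 2) \<le> (b - a) / 2 - e" using pi_gt_zero by linarith
    show "(b - a) / 2 - e \<le> (b - a) / 2" using e by linarith
    show "(b - a) / 2 \<le> pi / 2" using \<open>b \<le> a + pi\<close> by simp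
  qed
  then have c0: "c \<ge> 0" by (simp add: c_def)
  have c2: "c \<le> 2 * e"
  proof -
    have "\<bar>sin ((b - a) / 2) - sin ((b - a) / 2 - e)\<bar> \<le> e"
      using abs_sin_diff_le[of "(b - a) / 2" "(b - a) / 2 - e"] e by simp
    then show ?thesis by (simp add: c_def)
  qed
  define ys where "ys = [((a + b) / 2, K * c)]"
  have "chord a lo + chord hi b =
      chord (a + e) lo + chord hi (b - e) + (chord a (a + e) + chord (b - e) b)"
    using chord_split[of a lo "a + e"] chord_split[of hi b "b - e"] by simp
  moreover have "chord a (a + e) + chord (b - e) b = complex_of_real c * cis ((a + b) / 2)"
    by (simp add: chord_pair c_def)
  moreover have "a + e \<le> (a + b) / 2" "(a + b) / 2 \<le> b - e"
    using e le by (simp_all add: field_simps)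
  ultimately have "feasible K W lo hi (a + e) (b - e) ys"
    using feas e c0 K le by (simp add: feasible_def ys_def algebra_simps)
  then have "excess K M lo hi a b [(\<beta>, 0)] \<le> excess K M lo hi (a + e) (b - e) ys"
    using min by (auto simp: minimal_def)
  then have "2 * ((K + M) * e) \<le> K * c"
    by (simp add: excess_def ys_def algebra_simps)
  also have "\<dots> \<le> K * (2 * e)" using c2 K by simp
  finally show False using mult_pos_pos[OF M e(1)] by (simp add: algebra_simps)
qed

lemma cis_add_2pi: "cis (x + 2 * pi) = cis x"
  by (simp add: complex_eq_iff)

text \<open>Once the range extends below \<open>lo\<close>, a piece of positive length must sit at
  \<open>a\<close>, and the mirrored perturbation lemmas then exclude \<open>hi < b\<close>. A piece
  of length zero can be turned at will: placed at \<open>b\<close> it bounds the width by pi, after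
  which \<open>not_minimal_no_atom\<close> applies.\<close>

lemma minimal_low_end:
  assumes K: "K > 0" and M: "M > 0" and le: "lo \<le> hi"
    and min: "minimal K M W lo hi a b [(\<beta>, s)]" and "a < lo"
  shows "b = hi \<and> minimal K M W lo hi a b [(a, s)]"
proof -
  have feas: "feasible K W lo hi a b [(\<beta>, s)]"
    using min by (simp add: minimal_def)
  note F = feas[unfolded feasible_def, simplified]
  \<comment> \<open>Turning a piece changes neither end point nor excess if the piece is empty or
    its direction stays the same.\<close>
  have moved: "minimal K M W lo hi a b [(\<gamma>, s)]"
    if "a \<le> \<gamma>" "\<gamma> \<le> b" "s = 0 \<or> cis \<gamma> = cis \<beta>" for \<gamma>
    using that F by (intro minimal_eqI[OF min]) (auto simp: feasible_def excess_def)
  show ?thesis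
  proof (cases "s = 0")
    case s0: True
    have "a \<le> b" using F le by linarith
    then have m: "minimal K M W lo hi a b [(a, s)]" "minimal K M W lo hi a b [(b, s)]"
      using moved[of a] moved[of b] s0 by simp_all
    have "\<not> a + pi < b"
      using not_minimal_wide[OF K M le m(2)] \<open>a < lo\<close> F le by auto
    then have "\<not> hi < b"
      using not_minimal_no_atom[OF K M le, of W a b a] m(1) s0 \<open>a < lo\<close> by auto
    then show ?thesis using F m by auto
  next
    case False
    then have s: "s > 0" using F by simp
    have "\<beta> = a"
    proof (rule ccontr)
      assume "\<beta> \<noteq> a"
      then have "a < \<beta>" using F by simp
      then show False
        using not_minimal_atom_inside[OF K M le min \<open>a < lo\<close> _ _ s]
          not_minimal_wide[OF K M le min \<open>a < lo\<close>] F by fastforce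
    qed
    have "b < a + 2 * pi"
    proof (rule ccontr)
      assume b: "\<not> b < a + 2 * pi"
      then have "minimal K M W lo hi a b [(a + 2 * pi, s)]"
        using \<open>\<beta> = a\<close> cis_add_2pi[of a] by (intro moved) auto
      from not_minimal_wide[OF K M le this \<open>a < lo\<close>] show False
        using b pi_gt_zero by simp
    qed
    have "b = hi"
    proof (rule ccontr)
      assume "b \<noteq> hi"
      then have b: "- b < - hi" using F by simp
      have "minimal K M (cnj W) (- hi) (- lo) (- b) (- a) [(- a, s)]"
        using minimal_mirror[OF min] \<open>\<beta> = a\<close> by simp
      from not_minimal_atom_inside[OF K M _ this b _ _ s] not_minimal_wide[OF K M _ this b]
      show False using b le \<open>a < lo\<close> by fastforce
    qed
    then show ?thesis using min \<open>\<beta> = a\<close> by simp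
  qed
qed

lemma minimal_high_end:
  assumes K: "K > 0" and M: "M > 0" and le: "lo \<le> hi"
    and min: "minimal K M W lo hi a b [(\<beta>, s)]" and "hi < b"
  shows "a = lo \<and> minimal K M W lo hi a b [(b, s)]"
proof -
  have "minimal K M (cnj W) (- hi) (- lo) (- b) (- a) [(- \<beta>, s)]"
    using minimal_mirror[OF min] by simp
  from minimal_low_end[OF K M _ this] have
    *: "- a = - lo" "minimal K M (cnj W) (- hi) (- lo) (- b) (- a) [(- b, s)]"
    using assms by auto
  from minimal_mirror[OF *(2)] *(1) show ?thesis by simp
qed

subsection \<open>Lower bound for arbitrary paths\<close>

text \<open>Over n + 1 equal steps the quadratic errors sum to
  \<open>C * (y - x)\<^sup>2 / (n + 1)\<close>, which tends to 0.\<close>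

lemma increment_nonneg:
  fixes G :: "real \<Rightarrow> real"
  assumes "x \<le> y" and "\<And>s t. x \<le> s \<Longrightarrow> s \<le> t \<Longrightarrow> t \<le> y \<Longrightarrow> - (C * (t - s)\<^sup>2) \<le> G t - G s"
  shows "G x \<le> G y"
proof -
  have *: "- (C * (y - x)\<^sup>2) / (real n + 1) \<le> G y - G x" for n :: nat
  proof -
    define d where "d = (y - x) / (real n + 1)"
    have d: "0 \<le> d" "x + (real n + 1) * d = y"
      using assms(1) by (auto simp: d_def)
    have "- (C * d\<^sup>2) * real k \<le> G (x + real k * d) - G x" if "k \<le> n + 1" for k
      using that
    proof (induction k)
      case (Suc k)
      have "real (Suc k) * d \<le> (real n + 1) * d"
        using Suc.prems d by (intro mult_right_mono) auto
      then have "- (C * (x + real (Suc k) * d - (x + real k * d))\<^sup>2) \<le> G (x + real (Suc k) * d) - G (x + real k * d)"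
        using d by (intro assms(2)) (auto intro: mult_right_mono)
      moreover have "x + real (Suc k) * d - (x + real k * d) = d" by (simp add: algebra_simps)
      ultimately show ?case using Suc by (simp add: algebra_simps)
    qed simp
    from this[of "n + 1"] have "- (C * d\<^sup>2) * (real n + 1) \<le> G y - G x"
      using d by (simp add: add.commute)
    moreover have "(C * d\<^sup>2) * (real n + 1) = C * (y - x)\<^sup>2 / (real n + 1)"
      by (simp add: d_def power2_eq_square)
    ultimately show ?thesis by simp
  qed
  have "(\<lambda>n. - (C * (y - x)\<^sup>2) / (real n + 1)) \<longlonglongrightarrow> 0"
    using tendsto_mult_right[OF LIMSEQ_inverse_real_of_nat, of "- (C * (y - x)\<^sup>2)"]
    by (simp add: divide_inverse ac_simps)
  then have "0 \<le> G y - G x"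
    by (rule LIMSEQ_le_const2) (use * in auto)
  then show ?thesis by simp
qed

text \<open>
  Formally \<open>(H \<circ> \<alpha>)' = h(\<alpha>) \<alpha>' \<le> U h(\<alpha>)\<close>; comparing increments up to second order avoids
  differentiating the merely Lipschitz function \<open>\<alpha>\<close>.
\<close>

lemma climb_inequality:
  fixes \<alpha> h H :: "real \<Rightarrow> real"
  assumes "x \<le> y" "U \<ge> 0" "C \<ge> 0"
    and up: "\<And>s t. x \<le> s \<Longrightarrow> s \<le> t \<Longrightarrow> t \<le> y \<Longrightarrow> \<alpha> t - \<alpha> s \<le> U * (t - s)"
    and lip: "\<And>s t. x \<le> s \<Longrightarrow> s \<le> t \<Longrightarrow> t \<le> y \<Longrightarrow> \<bar>\<alpha> t - \<alpha> s\<bar> \<le> B * (t - s)"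
    and cont: "continuous_on {x..y} \<alpha>"
    and nonneg: "\<And>s. x \<le> s \<Longrightarrow> s \<le> y \<Longrightarrow> 0 \<le> h (\<alpha> s)"
    and H: "\<And>b. (H has_real_derivative h b) (at b)"
    and h: "\<And>b b'. \<bar>h b - h b'\<bar> \<le> C * \<bar>b - b'\<bar>"
  shows "H (\<alpha> y) - H (\<alpha> x) \<le> U * integral {x..y} (\<lambda>s. h (\<alpha> s))"
proof -
  define G where "G t = U * integral {x..t} (\<lambda>s. h (\<alpha> s)) - H (\<alpha> t)" for t
  have "C-lipschitz_on UNIV h"
    using h \<open>C \<ge> 0\<close> by (intro lipschitz_onI) (auto simp: dist_real_def)
  then have "continuous_on UNIV h" by (rule lipschitz_on_continuous_on)
  then have conth: "continuous_on {x..y} (\<lambda>s. h (\<alpha> s))"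
    using cont continuous_on_compose2 by blast
  \<comment> \<open>The term \<open>U * C * B\<close> bounds the error of freezing \<open>h\<close>
    at \<open>\<alpha> s\<close> in the integral, and \<open>C * B\<^sup>2\<close> that of
    linearizing \<open>H\<close>.\<close>
  have "- ((U * C * B + C * B\<^sup>2) * (t - s)\<^sup>2) \<le> G t - G s" if st: "x \<le> s" "s \<le> t" "t \<le> y" for s t
  proof -
    have int: "(\<lambda>s. h (\<alpha> s)) integrable_on {u..v}" if "x \<le> u" "v \<le> y" for u v
      using that by (intro integrable_continuous_real continuous_on_subset[OF conth]) auto
    have "integral {x..t} (\<lambda>s. h (\<alpha> s)) = integral {x..s} (\<lambda>s. h (\<alpha> s)) + integral {s..t} (\<lambda>s. h (\<alpha> s))"
      using st by (intro Henstock_Kurzweil_Integration.integral_combine[symmetric] int) auto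
    moreover have low: "(h (\<alpha> s) - C * (B * (t - s))) * (t - s) \<le> integral {s..t} (\<lambda>s. h (\<alpha> s))"
    proof -
      have "integral {s..t} (\<lambda>_. h (\<alpha> s) - C * (B * (t - s))) \<le> integral {s..t} (\<lambda>s. h (\<alpha> s))"
      proof (rule integral_le)
        show "h (\<alpha> s) - C * (B * (t - s)) \<le> h (\<alpha> r)" if "r \<in> {s..t}" for r
        proof -
          have "\<bar>\<alpha> r - \<alpha> s\<bar> \<le> B * (r - s)" using that st by (intro lip) auto
          moreover have "0 \<le> \<bar>\<alpha> t - \<alpha> s\<bar>" by simp
          moreover have "B * (r - s) \<le> B * (t - s)"
          proof (cases "B \<ge> 0")
            case True
            then show ?thesis using that by (intro mult_left_mono) auto
          next
            case False
            have "0 \<le> B * (t - s)" using lip[of s t] st by (meson abs_ge_zero order_trans)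
            moreover have "B * (r - s) \<le> 0" using False that by (simp add: mult_nonpos_nonneg)
            ultimately show ?thesis by linarith
          qed
          ultimately have "\<bar>h (\<alpha> r) - h (\<alpha> s)\<bar> \<le> C * (B * (t - s))"
            using h[of "\<alpha> r" "\<alpha> s"] \<open>C \<ge> 0\<close>
            by (meson dual_order.trans mult_left_mono)
          then show ?thesis by linarith
        qed
      qed (use st in \<open>auto intro!: int\<close>)
      then show ?thesis using st by (simp add: mult.commute)
    qed
    moreover have "H (\<alpha> t) - H (\<alpha> s) \<le> h (\<alpha> s) * (\<alpha> t - \<alpha> s) + C * (\<alpha> t - \<alpha> s)\<^sup>2"
    proof -
      have "\<exists>\<xi>. \<bar>\<xi> - \<alpha> s\<bar> \<le> \<bar>\<alpha> t - \<alpha> s\<bar> \<and> H (\<alpha> t) - H (\<alpha> s) = h \<xi> * (\<alpha> t - \<alpha> s)"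
      proof (cases "\<alpha> s" "\<alpha> t" rule: linorder_cases)
        case less
        from MVT2[OF this H] obtain z where "\<alpha> s < z" "z < \<alpha> t" "H (\<alpha> t) - H (\<alpha> s) = (\<alpha> t - \<alpha> s) * h z"
          by blast
        then show ?thesis by (intro exI[of _ z]) (auto simp: algebra_simps)
      next
        case greater
        from MVT2[OF this H] obtain z where "\<alpha> t < z" "z < \<alpha> s" "H (\<alpha> s) - H (\<alpha> t) = (\<alpha> s - \<alpha> t) * h z"
          by blast
        then show ?thesis by (intro exI[of _ z]) (auto simp: algebra_simps)
      qed auto
      then obtain \<xi> where \<xi>: "\<bar>\<xi> - \<alpha> s\<bar> \<le> \<bar>\<alpha> t - \<alpha> s\<bar>" "H (\<alpha> t) - H (\<alpha> s) = h \<xi> * (\<alpha> t - \<alpha> s)"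
        by blast
      have "(h \<xi> - h (\<alpha> s)) * (\<alpha> t - \<alpha> s) \<le> \<bar>h \<xi> - h (\<alpha> s)\<bar> * \<bar>\<alpha> t - \<alpha> s\<bar>"
        by (metis abs_ge_self abs_mult)
      also have "\<dots> \<le> (C * \<bar>\<alpha> t - \<alpha> s\<bar>) * \<bar>\<alpha> t - \<alpha> s\<bar>"
        using h[of \<xi> "\<alpha> s"] \<xi>(1) \<open>C \<ge> 0\<close>
        by (intro mult_right_mono) (auto intro: order_trans mult_left_mono)
      finally show ?thesis using \<xi>(2) by (simp add: power2_eq_square algebra_simps)
    qed
    \<comment> \<open>Here nonnegativity of \<open>h\<close> enters, since the rate bound
      \<open>U\<close> on \<alpha> is one-sided.\<close>
    moreover have "h (\<alpha> s) * (\<alpha> t - \<alpha> s) \<le> h (\<alpha> s) * (U * (t - s))"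
      using st by (intro mult_left_mono up nonneg) auto
    moreover have "C * (\<alpha> t - \<alpha> s)\<^sup>2 \<le> C * (B * (t - s))\<^sup>2"
      using lip[of s t] st \<open>C \<ge> 0\<close> by (intro mult_left_mono) (auto simp: abs_le_square_iff[symmetric])
    ultimately have
      "G t - G s \<ge> U * ((h (\<alpha> s) - C * (B * (t - s))) * (t - s)) - (h (\<alpha> s) * (U * (t - s)) + C * (B * (t - s))\<^sup>2)"
      using mult_left_mono[OF low \<open>U \<ge> 0\<close>] unfolding G_def by (simp add: distrib_left)
    then show ?thesis by (simp add: algebra_simps power2_eq_square)
  qed
  from increment_nonneg[OF \<open>x \<le> y\<close> this] show ?thesis by (simp add: G_def)
qed

section \<open>Controls and headings of an arbitrary path\<close>

context
  fixes U_L U_R :: real and p :: path_data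
  assumes U: "U_L > 0" "U_R > 0"
    and T: "final_time p \<ge> 0"
    and controls: "controls_in U_L U_R p"
    and dynamics: "satisfies_dynamics p"
begin

lemma control_integrable:
  assumes "0 \<le> s" "t \<le> final_time p"
  shows "control_L p integrable_on {s..t}" "control_R p integrable_on {s..t}"
proof -
  have int: "f integrable_on {0..final_time p}"
    if "f \<in> borel_measurable (lebesgue_on {0..final_time p})"
      "\<And>t. t \<in> {0..final_time p} \<Longrightarrow> f t \<in> {0..B}" for f :: "real \<Rightarrow> real" and B
  proof (rule measurable_bounded_by_integrable_imp_integrable_real[OF that(1)])
    show "(\<lambda>_. B) integrable_on {0..final_time p}" by (rule integrable_const_ivl)
    show "\<bar>f t\<bar> \<le> B" if "t \<in> {0..final_time p}" for t
      using \<open>\<And>t. t \<in> {0..final_time p} \<Longrightarrow> f t \<in> {0..B}\<close>[OF that] by simp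
  qed simp
  have "control_L p integrable_on {0..final_time p}" "control_R p integrable_on {0..final_time p}"
    using controls unfolding controls_in_def by (blast intro: int)+
  moreover have "{s..t} \<subseteq> {0..final_time p}" using assms by auto
  ultimately show "control_L p integrable_on {s..t}" "control_R p integrable_on {s..t}"
    by (blast intro: integrable_on_subinterval)+
qed

lemma control_integral_bounds:
  assumes "0 \<le> s" "s \<le> t" "t \<le> final_time p"
  shows "0 \<le> integral {s..t} (control_L p)" "integral {s..t} (control_L p) \<le> U_L * (t - s)"
    "0 \<le> integral {s..t} (control_R p)" "integral {s..t} (control_R p) \<le> U_R * (t - s)"
proof -
  note int = control_integrable[OF assms(1,3)]
  have b: "control_L p r \<in> {0..U_L}" "control_R p r \<in> {0..U_R}" if "r \<in> {s..t}" for r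
    using controls that assms by (auto simp: controls_in_def)
  show "0 \<le> integral {s..t} (control_L p)" "0 \<le> integral {s..t} (control_R p)"
    using int b by (auto intro!: integral_nonneg)
  have "integral {s..t} (control_L p) \<le> integral {s..t} (\<lambda>_. U_L)"
    "integral {s..t} (control_R p) \<le> integral {s..t} (\<lambda>_. U_R)"
    by (intro integral_le int integrable_const_ivl; use b in fastforce)+
  then show "integral {s..t} (control_L p) \<le> U_L * (t - s)"
    "integral {s..t} (control_R p) \<le> U_R * (t - s)"
    using assms by (simp_all add: mult.commute)
qed

lemma heading_increment:
  assumes "0 \<le> s" "s \<le> t" "t \<le> final_time p"
  shows "heading p t - heading p s = integral {s..t} (control_L p) - integral {s..t} (control_R p)"
proof -
  have *: "heading p r - heading p 0 = integral {0..r} (control_L p) - integral {0..r} (control_R p)"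
    if "r \<in> {0..final_time p}" for r
  proof -
    have "((\<lambda>s. control_L p s - control_R p s) has_integral (heading p r - heading p 0)) {0..r}"
      using dynamics that by (simp add: satisfies_dynamics_def)
    moreover have "((\<lambda>s. control_L p s - control_R p s) has_integral
        (integral {0..r} (control_L p) - integral {0..r} (control_R p))) {0..r}"
      using that by (intro has_integral_diff integrable_integral control_integrable) auto
    ultimately show ?thesis by (rule has_integral_unique)
  qed
  have "integral {0..t} f = integral {0..s} f + integral {s..t} f"
    if "f integrable_on {0..t}" for f :: "real \<Rightarrow> real"
    using assms that by (intro Henstock_Kurzweil_Integration.integral_combine[symmetric]) auto
  from this[of "control_L p"] this[of "control_R p"] show ?thesis
    using *[of s] *[of t] assms control_integrable[of 0 t] by auto
qed

lemma heading_continuous: "continuous_on {0..final_time p} (heading p)"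
proof -
  have "\<bar>heading p t - heading p s\<bar> \<le> (U_L + U_R) * (t - s)"
    if "0 \<le> s" "s \<le> t" "t \<le> final_time p" for s t
    using heading_increment[OF that] control_integral_bounds[OF that]
    by (simp add: algebra_simps abs_le_iff)
  then have "(U_L + U_R)-lipschitz_on {0..final_time p} (heading p)"
    using U by (intro lipschitz_on_leI) (auto simp: dist_real_def abs_minus_commute)
  then show ?thesis by (rule lipschitz_on_continuous_on)
qed

text \<open>
  \<open>w\<close> and the factor of \<open>c\<close> on the right are what is left of displacement and cost for straight pieces
  once the arcs sweeping \<open>[a, b]\<close> are paid for. The inequality says that no linear functional separates
  \<open>(w, m)\<close> from the cone generated by \<open>(cis \<beta>, 1)\<close> for \<open>\<beta>\<close> in \<open>[a, b]\<close>.
\<close>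

lemma calibration:
  fixes \<mu>_L \<mu>_R a b c n\<^sub>1 n\<^sub>2 :: real
  defines "K \<equiv> 1 / U_L + 1 / U_R" and "M \<equiv> \<mu>_L + \<mu>_R"
  defines "\<alpha>\<^sub>i \<equiv> heading p 0" and "\<alpha>\<^sub>f \<equiv> heading p (final_time p)"
  defines "w \<equiv> Complex (pos_x p (final_time p) - pos_x p 0) (pos_y p (final_time p) - pos_y p 0)
      - complex_of_real (1 / U_L) * chord \<alpha>\<^sub>i \<alpha>\<^sub>f - complex_of_real K * (chord a \<alpha>\<^sub>i + chord \<alpha>\<^sub>f b)"
  assumes \<mu>: "\<mu>_L \<ge> 0" "\<mu>_R \<ge> 0"
    and range: "\<And>t. t \<in> {0..final_time p} \<Longrightarrow> heading p t \<in> {a..b}"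
    and ta: "ta \<in> {0..final_time p}" "heading p ta = a"
    and tb: "tb \<in> {0..final_time p}" "heading p tb = b"
    and le: "\<alpha>\<^sub>i \<le> \<alpha>\<^sub>f"
    and c: "c \<ge> 0" "\<And>\<beta>. \<beta> \<in> {a..b} \<Longrightarrow> n\<^sub>1 * cos \<beta> + n\<^sub>2 * sin \<beta> \<le> c"
  shows "n\<^sub>1 * Re w + n\<^sub>2 * Im w \<le>
    c * (cost \<mu>_L \<mu>_R p - (1 / U_L + \<mu>_L) * (\<alpha>\<^sub>f - \<alpha>\<^sub>i) - (K + M) * ((\<alpha>\<^sub>i - a) + (b - \<alpha>\<^sub>f)))"
proof -
  \<comment> \<open>\<open>h\<close> is the slack of the linear functional, nonnegative on
    \<open>[a, b]\<close>, and \<open>H\<close> is its antiderivative. \<open>I x y\<close> is the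
    part of c times the cost minus the functional of the displacement that accrues on
    \<open>[x, y]\<close>.\<close>
  define h where "h \<beta> = c - n\<^sub>1 * cos \<beta> - n\<^sub>2 * sin \<beta>" for \<beta>
  define H where "H \<beta> = c * \<beta> - n\<^sub>1 * sin \<beta> + n\<^sub>2 * cos \<beta>" for \<beta>
  define C where "C = \<bar>n\<^sub>1\<bar> + \<bar>n\<^sub>2\<bar>"
  define I where "I x y = integral {x..y} (\<lambda>t. h (heading p t)) +
      c * \<mu>_L * integral {x..y} (control_L p) + c * \<mu>_R * integral {x..y} (control_R p)" for x y
  have H: "(H has_real_derivative h \<beta>) (at \<beta>)" for \<beta>
    unfolding H_def h_def by (auto intro!: derivative_eq_intros)
  have h: "\<bar>h x - h y\<bar> \<le> C * \<bar>x - y\<bar>" for x y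
  proof -
    have "\<bar>n\<^sub>1 * (cos y - cos x) + n\<^sub>2 * (sin y - sin x)\<bar> \<le>
        \<bar>n\<^sub>1\<bar> * \<bar>cos y - cos x\<bar> + \<bar>n\<^sub>2\<bar> * \<bar>sin y - sin x\<bar>"
      by (metis abs_mult abs_triangle_ineq)
    also have "\<dots> \<le> \<bar>n\<^sub>1\<bar> * \<bar>x - y\<bar> + \<bar>n\<^sub>2\<bar> * \<bar>x - y\<bar>"
      using abs_sin_diff_le[of y x] abs_cos_diff_le[of y x]
      by (intro add_mono mult_left_mono) (auto simp: abs_minus_commute)
    finally show ?thesis by (simp add: h_def C_def algebra_simps)
  qed
  have C: "C \<ge> 0" by (simp add: C_def)
  have nonneg: "0 \<le> h \<beta>" if "\<beta> \<in> {a..b}" for \<beta>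
    using c(2)[OF that] by (simp add: h_def)
  have cont: "continuous_on {x..y} (heading p)" if "0 \<le> x" "y \<le> final_time p" for x y
    using that by (intro continuous_on_subset[OF heading_continuous]) auto
  have conth: "continuous_on {x..y} (\<lambda>t. h (heading p t))" if "0 \<le> x" "y \<le> final_time p" for x y
    unfolding h_def by (intro continuous_intros cont that)
  have Lip: "\<bar>heading p t - heading p s\<bar> \<le> (U_L + U_R) * (t - s)"
      "heading p t - heading p s \<le> U_L * (t - s)" "heading p s - heading p t \<le> U_R * (t - s)"
    if "0 \<le> s" "s \<le> t" "t \<le> final_time p" for s t
    using heading_increment[OF that] control_integral_bounds[OF that]
    by (simp_all add: algebra_simps abs_le_iff)
  have up: "(H (heading p y) - H (heading p x)) / U_L + c * \<mu>_L * (heading p y - heading p x) \<le> I x y"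
    if xy: "0 \<le> x" "x \<le> y" "y \<le> final_time p" for x y
  proof -
    have "H (heading p y) - H (heading p x) \<le> U_L * integral {x..y} (\<lambda>s. h (heading p s))"
    proof (rule climb_inequality[where C=C and B="U_L + U_R"])
      show "heading p t - heading p s \<le> U_L * (t - s)"
        "\<bar>heading p t - heading p s\<bar> \<le> (U_L + U_R) * (t - s)"
        if "x \<le> s" "s \<le> t" "t \<le> y" for s t
        using Lip[of s t] that xy by auto
      show "0 \<le> h (heading p s)" if "x \<le> s" "s \<le> y" for s
        using that xy by (intro nonneg range) auto
    qed (use xy U C cont H h in auto)
    then have "(H (heading p y) - H (heading p x)) / U_L \<le> integral {x..y} (\<lambda>s. h (heading p s))"
      using U by (simp add: field_simps)
    moreover have "c * \<mu>_L * (heading p y - heading p x) \<le> c * \<mu>_L * integral {x..y} (control_L p)"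
      using heading_increment[OF xy] control_integral_bounds[OF xy] c \<mu> by (intro mult_left_mono) auto
    moreover have "0 \<le> c * \<mu>_R * integral {x..y} (control_R p)"
      using control_integral_bounds[OF xy] c \<mu> by simp
    ultimately show ?thesis by (simp add: I_def)
  qed
  have down: "(H (heading p x) - H (heading p y)) / U_R + c * \<mu>_R * (heading p x - heading p y) \<le> I x y"
    if xy: "0 \<le> x" "x \<le> y" "y \<le> final_time p" for x y
  proof -
    \<comment> \<open>A descent is a climb of the negated heading, for which
      \<open>- H (- \<beta>)\<close> is an antiderivative of \<open>h (- \<beta>)\<close>.\<close>
    have "- H (- (- heading p y)) - - H (- (- heading p x)) \<le>
        U_R * integral {x..y} (\<lambda>s. h (- (- heading p s)))"
    proof (rule climb_inequality[where C=C and B="U_L + U_R" and H="\<lambda>\<beta>. - H (- \<beta>)"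
          and h="\<lambda>\<beta>. h (- \<beta>)" and \<alpha>="\<lambda>t. - heading p t"])
      show "((\<lambda>\<beta>. - H (- \<beta>)) has_real_derivative h (- \<beta>)) (at \<beta>)" for \<beta>
        unfolding H_def h_def by (auto intro!: derivative_eq_intros)
      show "\<bar>h (- \<beta>) - h (- \<beta>')\<bar> \<le> C * \<bar>\<beta> - \<beta>'\<bar>" for \<beta> \<beta>'
        using h[of "- \<beta>" "- \<beta>'"] by (simp add: abs_minus_commute)
      show "continuous_on {x..y} (\<lambda>t. - heading p t)"
        using cont[of x y] xy by (intro continuous_intros) auto
      show "- heading p t - - heading p s \<le> U_R * (t - s)"
        "\<bar>- heading p t - - heading p s\<bar> \<le> (U_L + U_R) * (t - s)"
        if "x \<le> s" "s \<le> t" "t \<le> y" for s t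
        using Lip[of s t] that xy by auto
      show "0 \<le> h (- (- heading p s))" if "x \<le> s" "s \<le> y" for s
        using nonneg[OF range[of s]] that xy by simp
    qed (use xy U C in auto)
    then have "(H (heading p x) - H (heading p y)) / U_R \<le> integral {x..y} (\<lambda>s. h (heading p s))"
      using U by (simp add: field_simps)
    moreover have "c * \<mu>_R * (heading p x - heading p y) \<le> c * \<mu>_R * integral {x..y} (control_R p)"
      using heading_increment[OF xy] control_integral_bounds[OF xy] c \<mu> by (intro mult_left_mono) auto
    moreover have "0 \<le> c * \<mu>_L * integral {x..y} (control_L p)"
      using control_integral_bounds[OF xy] c \<mu> by simp
    ultimately show ?thesis by (simp add: I_def)
  qed
  have split: "I x z = I x y + I y z" if "0 \<le> x" "x \<le> y" "y \<le> z" "z \<le> final_time p" for x y z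
  proof -
    have "integral {x..z} f = integral {x..y} f + integral {y..z} f"
      if "f integrable_on {x..z}" for f :: "real \<Rightarrow> real"
      using that \<open>x \<le> y\<close> \<open>y \<le> z\<close>
      by (intro Henstock_Kurzweil_Integration.integral_combine[symmetric]) auto
    note this[OF control_integrable(1)[of x z]] this[OF control_integrable(2)[of x z]]
      this[OF integrable_continuous_real[OF conth[of x z]]]
    with that show ?thesis by (simp add: I_def algebra_simps)
  qed
  have total: "I 0 (final_time p) = c * cost \<mu>_L \<mu>_R p -
      n\<^sub>1 * (pos_x p (final_time p) - pos_x p 0) - n\<^sub>2 * (pos_y p (final_time p) - pos_y p 0)"
  proof -
    have "((\<lambda>t. c * 1 - n\<^sub>1 * cos (heading p t) - n\<^sub>2 * sin (heading p t)) has_integral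
        (c * (final_time p - 0) - n\<^sub>1 * (pos_x p (final_time p) - pos_x p 0)
          - n\<^sub>2 * (pos_y p (final_time p) - pos_y p 0))) {0..final_time p}"
      using dynamics T has_integral_const_real[of "1::real" 0 "final_time p"]
      by (intro has_integral_diff has_integral_mult_right) (auto simp: satisfies_dynamics_def)
    then have "integral {0..final_time p} (\<lambda>t. h (heading p t)) = c * final_time p
        - n\<^sub>1 * (pos_x p (final_time p) - pos_x p 0) - n\<^sub>2 * (pos_y p (final_time p) - pos_y p 0)"
      by (simp add: h_def integral_unique)
    moreover have "((\<lambda>t. 1 + \<mu>_L * control_L p t + \<mu>_R * control_R p t) has_integral
        (final_time p - 0 + \<mu>_L * integral {0..final_time p} (control_L p) +
          \<mu>_R * integral {0..final_time p} (control_R p))) {0..final_time p}"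
      using has_integral_const_real[of "1::real" 0 "final_time p"] T
      by (intro has_integral_add has_integral_mult_right integrable_integral control_integrable) auto
    then have "cost \<mu>_L \<mu>_R p = final_time p + \<mu>_L * integral {0..final_time p} (control_L p) +
          \<mu>_R * integral {0..final_time p} (control_R p)"
      unfolding cost_def by (simp add: integral_unique)
    ultimately show ?thesis by (simp add: I_def algebra_simps)
  qed
  have rng: "\<alpha>\<^sub>i \<in> {a..b}" "\<alpha>\<^sub>f \<in> {a..b}"
    using range[of 0] range[of "final_time p"] T by (auto simp: \<alpha>\<^sub>i_def \<alpha>\<^sub>f_def)
  \<comment> \<open>The left side is the price of sweeping from the initial heading down to
    \<open>a\<close>, up to \<open>b\<close> and down to the final heading.\<close>
  have "(H \<alpha>\<^sub>i - H a) / U_R + c * \<mu>_R * (\<alpha>\<^sub>i - a) + ((H b - H a) / U_L + c * \<mu>_L * (b - a))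
      + ((H b - H \<alpha>\<^sub>f) / U_R + c * \<mu>_R * (b - \<alpha>\<^sub>f)) \<le> I 0 (final_time p)"
  proof (cases "ta \<le> tb")
    case True
    have "I 0 (final_time p) = I 0 ta + I ta tb + I tb (final_time p)"
      using split[of 0 ta "final_time p"] split[of ta tb "final_time p"] ta tb True by simp
    then show ?thesis
      using down[of 0 ta] up[of ta tb] down[of tb "final_time p"] ta tb True
      by (simp add: \<alpha>\<^sub>i_def \<alpha>\<^sub>f_def)
  next
    case False
    have "I 0 (final_time p) = I 0 tb + I tb ta + I ta (final_time p)"
      using split[of 0 tb "final_time p"] split[of tb ta "final_time p"] ta tb False by simp
    then have "(H b - H \<alpha>\<^sub>i) / U_L + c * \<mu>_L * (b - \<alpha>\<^sub>i) + ((H b - H a) / U_R + c * \<mu>_R * (b - a))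
      + ((H \<alpha>\<^sub>f - H a) / U_L + c * \<mu>_L * (\<alpha>\<^sub>f - a)) \<le> I 0 (final_time p)"
      using up[of 0 tb] down[of tb ta] up[of ta "final_time p"] ta tb False
      by (simp add: \<alpha>\<^sub>i_def \<alpha>\<^sub>f_def)
    \<comment> \<open>If \<open>b\<close> is visited first, the bound exceeds the wanted one by the
      price of one left and one right sweep between \<open>\<alpha>\<^sub>i\<close> and
      \<open>\<alpha>\<^sub>f\<close>, which is nonnegative because \<open>H\<close> is monotone
      there.\<close>
    moreover have "H \<alpha>\<^sub>i \<le> H \<alpha>\<^sub>f"
    proof (rule DERIV_nonneg_imp_nondecreasing[OF le])
      show "\<exists>y. DERIV H \<beta> :> y \<and> 0 \<le> y" if "\<alpha>\<^sub>i \<le> \<beta>" "\<beta> \<le> \<alpha>\<^sub>f" for \<beta>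
        using H[of \<beta>] nonneg[of \<beta>] rng that by (intro exI[of _ "h \<beta>"]) auto
    qed
    then have "0 \<le> (H \<alpha>\<^sub>f - H \<alpha>\<^sub>i) / U_L" "0 \<le> (H \<alpha>\<^sub>f - H \<alpha>\<^sub>i) / U_R"
      "0 \<le> c * \<mu>_L * (\<alpha>\<^sub>f - \<alpha>\<^sub>i)" "0 \<le> c * \<mu>_R * (\<alpha>\<^sub>f - \<alpha>\<^sub>i)"
      using U c \<mu> le by auto
    ultimately show ?thesis
      by (simp add: diff_divide_distrib algebra_simps)
  qed
  \<comment> \<open>The linear part of \<open>H\<close> yields the arc lengths in the cost, its
    trigonometric part the chords in \<open>w\<close>.\<close>
  then show ?thesis
    unfolding total w_def
    by (simp add: H_def K_def M_def diff_divide_distrib add_divide_distrib algebra_simps)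
qed

end

subsection \<open>Paths composed of segments\<close>

text \<open>The displacement of an arc is its radius times the integral of \<open>cis\<close> over
  the headings swept, in either direction of travel; hence the right arc also uses a
  \<open>chord\<close> from its smaller to its larger heading.\<close>

fun advance :: "real \<Rightarrow> real \<Rightarrow> segment \<times> real \<Rightarrow> complex \<times> real \<Rightarrow> complex \<times> real" where
  "advance U_L U_R (L, d) (z, \<alpha>) =
     (z + complex_of_real (1 / U_L) * chord \<alpha> (\<alpha> + U_L * d), \<alpha> + U_L * d)"
| "advance U_L U_R (R, d) (z, \<alpha>) =
     (z + complex_of_real (1 / U_R) * chord (\<alpha> - U_R * d) \<alpha>, \<alpha> - U_R * d)"
| "advance U_L U_R (S, d) (z, \<alpha>) = (z + complex_of_real d * cis \<alpha>, \<alpha>)"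

definition run ::
    "real \<Rightarrow> real \<Rightarrow> (segment \<times> real) list \<Rightarrow> complex \<times> real \<Rightarrow> complex \<times> real" where
  "run U_L U_R = fold (advance U_L U_R)"

fun segment_cost :: "real \<Rightarrow> real \<Rightarrow> real \<Rightarrow> real \<Rightarrow> segment \<times> real \<Rightarrow> real" where
  "segment_cost U_L U_R \<mu>_L \<mu>_R (L, d) = (1 + \<mu>_L * U_L) * d"
| "segment_cost U_L U_R \<mu>_L \<mu>_R (R, d) = (1 + \<mu>_R * U_R) * d"
| "segment_cost U_L U_R \<mu>_L \<mu>_R (S, d) = d"

definition total_cost ::
    "real \<Rightarrow> real \<Rightarrow> real \<Rightarrow> real \<Rightarrow> (segment \<times> real) list \<Rightarrow> real" where
  "total_cost U_L U_R \<mu>_L \<mu>_R xs = sum_list (map (segment_cost U_L U_R \<mu>_L \<mu>_R) xs)"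

definition end_state :: "path_data \<Rightarrow> complex \<times> real" where
  "end_state p =
     (Complex (pos_x p (final_time p)) (pos_y p (final_time p)), heading p (final_time p))"

text \<open>The start heading is prescribed as a real number, so \<open>run\<close> fixes the lift
  of the final heading and not only its residue modulo 2 pi. The breakpoints in the last conjunct
  are those demanded by \<open>of_type\<close>.\<close>

definition realises ::
    "real \<Rightarrow> real \<Rightarrow> real \<Rightarrow> real \<Rightarrow> (segment \<times> real) list \<Rightarrow> complex \<times> real \<Rightarrow> path_data \<Rightarrow> bool" where
  "realises U_L U_R \<mu>_L \<mu>_R xs c p \<longleftrightarrow>
     final_time p \<ge> 0 \<and> controls_in U_L U_R p \<and> satisfies_dynamics p \<and>
     (Complex (pos_x p 0) (pos_y p 0), heading p 0) = c \<and> end_state p = run U_L U_R xs c \<and>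
     cost \<mu>_L \<mu>_R p = total_cost U_L U_R \<mu>_L \<mu>_R xs \<and>
     (\<exists>\<tau> :: nat \<Rightarrow> real. \<tau> 0 = 0 \<and> \<tau> (length xs) = final_time p \<and>
        (\<forall>j < length xs. \<tau> j < \<tau> (Suc j) \<and>
           is_segment_on U_L U_R p (fst (xs ! j)) (\<tau> j) (\<tau> (Suc j))))"

lemma advance_zero: "advance U_L U_R (X, 0) c = c"
  by (cases X; cases c) (simp_all add: chord_def)

definition extend :: "real \<Rightarrow> real \<Rightarrow> path_data \<Rightarrow> segment \<Rightarrow> real \<Rightarrow> path_data" where
  "extend U_L U_R p X d = (let T = final_time p;
       state = (\<lambda>t. advance U_L U_R (X, t - T) (end_state p)) in
     \<lparr>final_time = T + d,
      control_L = (\<lambda>t. if t \<le> T then control_L p t else fst (segment_controls U_L U_R X)),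
      control_R = (\<lambda>t. if t \<le> T then control_R p t else snd (segment_controls U_L U_R X)),
      pos_x = (\<lambda>t. if t \<le> T then pos_x p t else Re (fst (state t))),
      pos_y = (\<lambda>t. if t \<le> T then pos_y p t else Im (fst (state t))),
      heading = (\<lambda>t. if t \<le> T then heading p t else snd (state t))\<rparr>)"

lemma advance_derivative:
  fixes U_L U_R T :: real and c :: "complex \<times> real" and X :: segment
  assumes "U_L > 0" "U_R > 0"
  defines "g \<equiv> (\<lambda>t. advance U_L U_R (X, t - T) c)"
  shows "((\<lambda>t. Re (fst (g t))) has_vector_derivative cos (snd (g t))) (at t within A)"
    "((\<lambda>t. Im (fst (g t))) has_vector_derivative sin (snd (g t))) (at t within A)"
    "((\<lambda>t. snd (g t)) has_vector_derivative
       fst (segment_controls U_L U_R X) - snd (segment_controls U_L U_R X)) (at t within A)"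
  unfolding g_def using assms
  by (cases X; cases c; simp;
      auto intro!: derivative_eq_intros
        simp flip: has_real_derivative_iff_has_vector_derivative)+

lemma has_integral_glue:
  fixes f :: "real \<Rightarrow> real"
  assumes "0 \<le> T" "T < t" and "(f has_integral I) {0..T}"
    and "\<And>s. s \<in> {0..T} \<Longrightarrow> F s = f s" "\<And>s. T < s \<Longrightarrow> s \<le> t \<Longrightarrow> F s = g s"
    and "(g has_integral J) {T..t}"
  shows "(F has_integral (I + J)) {0..t}"
proof (rule has_integral_combine)
  show "(F has_integral I) {0..T}"
    using has_integral_eq[of "{0..T}" f F I] assms by simp
  show "(F has_integral J) {T..t}"
    using assms by (intro has_integral_spike_finite[of "{T}" _ F g J]) auto
qed (use assms in auto)

lemma integral_advance:
  fixes U_L U_R T :: real and c :: "complex \<times> real" and X :: segment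
  assumes U: "U_L > 0" "U_R > 0" and "T < t"
  defines "g \<equiv> (\<lambda>t. advance U_L U_R (X, t - T) c)"
  shows "((\<lambda>s. cos (snd (g s))) has_integral (Re (fst (g t)) - Re (fst c))) {T..t}"
    "((\<lambda>s. sin (snd (g s))) has_integral (Im (fst (g t)) - Im (fst c))) {T..t}"
    "((\<lambda>s. fst (segment_controls U_L U_R X) - snd (segment_controls U_L U_R X))
       has_integral (snd (g t) - snd c)) {T..t}"
proof -
  note D = advance_derivative[OF U, of X T c]
  show "((\<lambda>s. cos (snd (g s))) has_integral (Re (fst (g t)) - Re (fst c))) {T..t}"
    using fundamental_theorem_of_calculus[OF _ D(1), of T t] \<open>T < t\<close>
    by (simp add: g_def advance_zero)
  show "((\<lambda>s. sin (snd (g s))) has_integral (Im (fst (g t)) - Im (fst c))) {T..t}"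
    using fundamental_theorem_of_calculus[OF _ D(2), of T t] \<open>T < t\<close>
    by (simp add: g_def advance_zero)
  show "((\<lambda>s. fst (segment_controls U_L U_R X) - snd (segment_controls U_L U_R X))
       has_integral (snd (g t) - snd c)) {T..t}"
    using fundamental_theorem_of_calculus[OF _ D(3), of T t] \<open>T < t\<close>
    by (simp add: g_def advance_zero)
qed

lemma realises_extend:
  assumes U: "U_L > 0" "U_R > 0" and p: "realises U_L U_R \<mu>_L \<mu>_R xs c p" and d: "d > 0"
  shows "realises U_L U_R \<mu>_L \<mu>_R (xs @ [(X, d)]) c (extend U_L U_R p X d)"
proof -
  define T where "T = final_time p"
  define q where "q = extend U_L U_R p X d"
  define g where "g t = advance U_L U_R (X, t - T) (end_state p)" for t
  define uL uR where "uL = fst (segment_controls U_L U_R X)" and "uR = snd (segment_controls U_L U_R X)"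
  have q: "final_time q = T + d"
    "control_L q t = (if t \<le> T then control_L p t else uL)"
    "control_R q t = (if t \<le> T then control_R p t else uR)"
    "pos_x q t = (if t \<le> T then pos_x p t else Re (fst (g t)))"
    "pos_y q t = (if t \<le> T then pos_y p t else Im (fst (g t)))"
    "heading q t = (if t \<le> T then heading p t else snd (g t))" for t
    by (simp_all add: q_def extend_def Let_def T_def g_def uL_def uR_def)
  have T: "T \<ge> 0" and ctrl: "controls_in U_L U_R p" and dyn: "satisfies_dynamics p"
    and start: "(Complex (pos_x p 0) (pos_y p 0), heading p 0) = c"
    and final: "end_state p = run U_L U_R xs c"
    and cst: "cost \<mu>_L \<mu>_R p = total_cost U_L U_R \<mu>_L \<mu>_R xs"
    using p by (auto simp: realises_def T_def)
  from p obtain \<tau> :: "nat \<Rightarrow> real" where \<tau>: "\<tau> 0 = 0" "\<tau> (length xs) = T"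
    "\<And>j. j < length xs \<Longrightarrow> \<tau> j < \<tau> (Suc j) \<and> is_segment_on U_L U_R p (fst (xs ! j)) (\<tau> j) (\<tau> (Suc j))"
    unfolding realises_def T_def by blast
  have u: "uL \<in> {0..U_L}" "uR \<in> {0..U_R}"
    using U by (cases X; simp add: uL_def uR_def)+
  note intp = control_integrable[OF U T[unfolded T_def] ctrl dyn, of 0 T]
  have const: "((\<lambda>_. k) has_integral k * (t - T)) {T..t}" if "T < t" for k t :: real
    using has_integral_const_real[of k T t] that by (simp add: mult.commute)
  have glue: "(F has_integral (I + J)) {0..t}"
    if "T < t" "(f has_integral I) {0..T}" "(h has_integral J) {T..t}"
      "\<And>s. s \<in> {0..T} \<Longrightarrow> F s = f s" "\<And>s. T < s \<Longrightarrow> F s = h s" for F f h :: "real \<Rightarrow> real" and I J t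
    using that T by (intro has_integral_glue[of T t f I F h J]) auto
  have int: "(control_L q has_integral (integral {0..T} (control_L p) + uL * d)) {0..T + d}"
    "(control_R q has_integral (integral {0..T} (control_R p) + uR * d)) {0..T + d}"
  proof -
    have T': "T < T + d" "T + d - T = d" using d by simp_all
    note const' = const[OF T'(1), unfolded T'(2)]
    have ints: "(control_L p has_integral integral {0..T} (control_L p)) {0..T}"
      "(control_R p has_integral integral {0..T} (control_R p)) {0..T}"
      using intp by (simp_all add: integrable_integral T_def)
    show "(control_L q has_integral (integral {0..T} (control_L p) + uL * d)) {0..T + d}"
      by (rule glue[OF T'(1) ints(1) const']) (simp_all add: q)
    show "(control_R q has_integral (integral {0..T} (control_R p) + uR * d)) {0..T + d}"
      by (rule glue[OF T'(1) ints(2) const']) (simp_all add: q)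
  qed
  have ctrlq: "controls_in U_L U_R q"
    unfolding controls_in_def
  proof (intro conjI)
    show "control_L q \<in> borel_measurable (lebesgue_on {0..final_time q})"
      "control_R q \<in> borel_measurable (lebesgue_on {0..final_time q})"
      \<comment> \<open>Measurability of the glued controls is read off from their
        integrability.\<close>
      unfolding q(1) by (rule integrable_imp_measurable, rule has_integral_integrable, rule int)+
    show "\<forall>t\<in>{0..final_time q}. control_L q t \<in> {0..U_L} \<and> control_R q t \<in> {0..U_R}"
      using ctrl u by (auto simp: q controls_in_def T_def)
  qed
  have dynq: "satisfies_dynamics q"
    unfolding satisfies_dynamics_def
  proof (intro ballI)
    fix t assume t: "t \<in> {0..final_time q}"
    show "((\<lambda>s. cos (heading q s)) has_integral (pos_x q t - pos_x q 0)) {0..t} \<and>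
        ((\<lambda>s. sin (heading q s)) has_integral (pos_y q t - pos_y q 0)) {0..t} \<and>
        ((\<lambda>s. control_L q s - control_R q s) has_integral (heading q t - heading q 0)) {0..t}"
    proof (cases "t \<le> T")
      case True
      have "((\<lambda>s. cos (heading p s)) has_integral (pos_x p t - pos_x p 0)) {0..t}"
        "((\<lambda>s. sin (heading p s)) has_integral (pos_y p t - pos_y p 0)) {0..t}"
        "((\<lambda>s. control_L p s - control_R p s) has_integral (heading p t - heading p 0)) {0..t}"
        using dyn t True by (auto simp: satisfies_dynamics_def T_def)
      moreover have "(F has_integral k) {0..t} \<longleftrightarrow> (f has_integral k) {0..t}"
        if "\<And>s. s \<le> T \<Longrightarrow> F s = f s" for F f :: "real \<Rightarrow> real" and k
        using that True by (intro has_integral_cong) auto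
      note this[of "\<lambda>s. cos (heading q s)" "\<lambda>s. cos (heading p s)"]
        this[of "\<lambda>s. sin (heading q s)" "\<lambda>s. sin (heading p s)"]
        this[of "\<lambda>s. control_L q s - control_R q s" "\<lambda>s. control_L p s - control_R p s"]
      ultimately have "((\<lambda>s. cos (heading q s)) has_integral (pos_x p t - pos_x p 0)) {0..t}"
        "((\<lambda>s. sin (heading q s)) has_integral (pos_y p t - pos_y p 0)) {0..t}"
        "((\<lambda>s. control_L q s - control_R q s) has_integral (heading p t - heading p 0)) {0..t}"
        by (simp_all add: q)
      then show ?thesis using True T by (simp add: q)
    next
      case False
      have D: "((\<lambda>s. cos (heading p s)) has_integral (pos_x p T - pos_x p 0)) {0..T}"
        "((\<lambda>s. sin (heading p s)) has_integral (pos_y p T - pos_y p 0)) {0..T}"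
        "((\<lambda>s. control_L p s - control_R p s) has_integral (heading p T - heading p 0)) {0..T}"
        using dyn T by (auto simp: satisfies_dynamics_def T_def)
      note A = integral_advance[OF U, of T t X "end_state p", folded g_def uL_def uR_def]
      have "T < t" using False by simp
      have "((\<lambda>s. cos (heading q s)) has_integral
          ((pos_x p T - pos_x p 0) + (Re (fst (g t)) - Re (fst (end_state p))))) {0..t}"
        by (rule glue[OF \<open>T < t\<close> D(1) A(1)[OF \<open>T < t\<close>]]) (auto simp: q)
      moreover have "((\<lambda>s. sin (heading q s)) has_integral
          ((pos_y p T - pos_y p 0) + (Im (fst (g t)) - Im (fst (end_state p))))) {0..t}"
        by (rule glue[OF \<open>T < t\<close> D(2) A(2)[OF \<open>T < t\<close>]]) (auto simp: q)
      moreover have "((\<lambda>s. control_L q s - control_R q s) has_integral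
          ((heading p T - heading p 0) + (snd (g t) - snd (end_state p)))) {0..t}"
        by (rule glue[OF \<open>T < t\<close> D(3) A(3)[OF \<open>T < t\<close>]]) (auto simp: q)
      ultimately show ?thesis
        using False T by (simp add: q end_state_def T_def)
    qed
  qed
  have endq: "end_state q = run U_L U_R (xs @ [(X, d)]) c"
    using d by (simp add: end_state_def[of q] q run_def g_def final[unfolded run_def, symmetric])
  have costq: "cost \<mu>_L \<mu>_R q = total_cost U_L U_R \<mu>_L \<mu>_R (xs @ [(X, d)])"
  proof -
    have "((\<lambda>t. 1 + \<mu>_L * control_L p t + \<mu>_R * control_R p t) has_integral cost \<mu>_L \<mu>_R p) {0..T}"
      unfolding cost_def T_def[symmetric]
      using integrable_on_mult_right[OF intp(1), of \<mu>_L] integrable_on_mult_right[OF intp(2), of \<mu>_R]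
      by (intro integrable_integral integrable_add integrable_const_ivl) (simp_all add: T_def)
    moreover have "T < T + d" using d by simp
    ultimately have "((\<lambda>t. 1 + \<mu>_L * control_L q t + \<mu>_R * control_R q t) has_integral
        (cost \<mu>_L \<mu>_R p + (1 + \<mu>_L * uL + \<mu>_R * uR) * (T + d - T))) {0..T + d}"
      by (intro glue[OF _ _ const]) (auto simp: q)
    then have "cost \<mu>_L \<mu>_R q = cost \<mu>_L \<mu>_R p + (1 + \<mu>_L * uL + \<mu>_R * uR) * d"
      by (simp add: cost_def q(1) integral_unique)
    moreover have "(1 + \<mu>_L * uL + \<mu>_R * uR) * d = segment_cost U_L U_R \<mu>_L \<mu>_R (X, d)"
      by (cases X) (simp_all add: uL_def uR_def)
    ultimately show ?thesis by (simp add: cst total_cost_def)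
  qed
  have segs: "\<exists>\<tau> :: nat \<Rightarrow> real. \<tau> 0 = 0 \<and> \<tau> (length (xs @ [(X, d)])) = final_time q \<and>
      (\<forall>j < length (xs @ [(X, d)]). \<tau> j < \<tau> (Suc j) \<and>
         is_segment_on U_L U_R q (fst ((xs @ [(X, d)]) ! j)) (\<tau> j) (\<tau> (Suc j)))"
  proof (intro exI[of _ "\<tau>(Suc (length xs) := T + d)"] conjI allI impI)
    have mono: "\<tau> j \<le> T" if "j \<le> length xs" for j
      using that
    proof (induction j rule: inc_induct)
      case (step n)
      then show ?case using \<tau>(3)[of n] by linarith
    qed (simp add: \<tau>(2))
    fix j assume "j < length (xs @ [(X, d)])"
    then consider "j < length xs" | "j = length xs" by fastforce
    then show "(\<tau>(Suc (length xs) := T + d)) j < (\<tau>(Suc (length xs) := T + d)) (Suc j)"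
      using \<tau> d by cases auto
    from \<open>j < length (xs @ [(X, d)])\<close> consider "j < length xs" | "j = length xs" by fastforce
    then show "is_segment_on U_L U_R q (fst ((xs @ [(X, d)]) ! j))
        ((\<tau>(Suc (length xs) := T + d)) j) ((\<tau>(Suc (length xs) := T + d)) (Suc j))"
    proof cases
      case 1
      have "is_segment_on U_L U_R p (fst (xs ! j)) (\<tau> j) (\<tau> (Suc j))" "\<tau> (Suc j) \<le> T"
        using \<tau>(3)[OF 1] mono[of "Suc j"] 1 by auto
      then have "is_segment_on U_L U_R q (fst (xs ! j)) (\<tau> j) (\<tau> (Suc j))"
        unfolding is_segment_on_def by eventually_elim (use \<open>\<tau> (Suc j) \<le> T\<close> in \<open>auto simp: q\<close>)
      then show ?thesis using 1 by (simp add: nth_append)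
    next
      case 2
      \<comment> \<open>At the junction \<open>T\<close> the extended path keeps the old control
        values, so this point is discarded as a null set.\<close>
      have "AE t in lebesgue. t \<noteq> T"
        by (rule AE_I'[of "{T}"]) (auto simp flip: negligible_iff_null_sets)
      then have "AE t in lebesgue. t \<in> {T..T + d} \<longrightarrow>
          (control_L q t, control_R q t) = segment_controls U_L U_R X"
        by eventually_elim (auto simp: q uL_def uR_def)
      then show ?thesis using 2 \<tau>(2) by (simp add: is_segment_on_def)
    qed
  qed (use \<tau> in \<open>auto simp: q\<close>)
  show ?thesis
    unfolding realises_def q_def[symmetric]
    using T d start ctrlq dynq endq costq segs by (auto simp: q)
qed

lemma realises_exists:
  assumes U: "U_L > 0" "U_R > 0" and "\<And>X d. (X, d) \<in> set xs \<Longrightarrow> d > 0"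
  shows "\<exists>p. realises U_L U_R \<mu>_L \<mu>_R xs c p"
  using assms(3)
proof (induction xs rule: rev_induct)
  case Nil
  define p where "p = \<lparr>final_time = 0, control_L = (\<lambda>_. 0), control_R = (\<lambda>_. 0),
    pos_x = (\<lambda>_. Re (fst c)), pos_y = (\<lambda>_. Im (fst c)), heading = (\<lambda>_. snd c)\<rparr>"
  have "realises U_L U_R \<mu>_L \<mu>_R [] c p"
    unfolding realises_def
  proof (intro conjI)
    show "\<exists>\<tau> :: nat \<Rightarrow> real. \<tau> 0 = 0 \<and> \<tau> (length []) = final_time p \<and>
      (\<forall>j < length []. \<tau> j < \<tau> (Suc j) \<and> is_segment_on U_L U_R p (fst ([] ! j)) (\<tau> j) (\<tau> (Suc j)))"
      by (rule exI[of _ "\<lambda>_. 0"]) (simp add: p_def)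
    show "satisfies_dynamics p"
      using has_integral_refl[of "\<lambda>_. cos (snd c)" "0::real"] has_integral_refl[of "\<lambda>_. sin (snd c)" "0::real"]
      by (simp add: satisfies_dynamics_def p_def)
    show "end_state p = run U_L U_R [] c" "cost \<mu>_L \<mu>_R p = total_cost U_L U_R \<mu>_L \<mu>_R []"
      by (simp_all add: p_def end_state_def run_def cost_def total_cost_def)
    show "controls_in U_L U_R p" using U by (simp add: p_def controls_in_def)
  qed (simp_all add: p_def)
  then show ?case by blast
next
  case (snoc x xs)
  have "d > 0" if "(X, d) \<in> set xs" for X d
    using snoc.prems[of X d] that by simp
  from snoc.IH[OF this] obtain p where "realises U_L U_R \<mu>_L \<mu>_R xs c p" ..
  moreover obtain X d where "x = (X, d)" by (cases x)
  ultimately show ?case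
    using realises_extend[OF U, of \<mu>_L \<mu>_R xs c p d X] snoc.prems[of X d] by auto
qed

section \<open>Routes: right arc, interrupted left arc, right arc\<close>

fun climb :: "real \<Rightarrow> real \<Rightarrow> (real \<times> real) list \<Rightarrow> real \<Rightarrow> (segment \<times> real) list" where
  "climb U a [] b = [(L, (b - a) / U)]"
| "climb U a ((\<beta>, s) # xs) b = (L, (\<beta> - a) / U) # (S, s) # climb U \<beta> xs b"

text \<open>Segments may have length zero here. They are filtered out only when a path is built,
  since the word depends on which of them vanish.\<close>

definition route ::
    "real \<Rightarrow> real \<Rightarrow> real \<Rightarrow> real \<Rightarrow> real \<Rightarrow> real \<Rightarrow> (real \<times> real) list \<Rightarrow> (segment \<times> real) list" where
  "route U_L U_R lo hi a b xs = (R, (lo - a) / U_R) # climb U_L a xs b @ [(R, (b - hi) / U_R)]"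

lemma run_climb:
  "U_L > 0 \<Longrightarrow> run U_L U_R (climb U_L a xs b) (z, a) =
     (z + complex_of_real (1 / U_L) * chord a b + atoms xs, b)"
proof (induction xs arbitrary: a z)
  case (Cons x xs)
  obtain \<beta> s where x: "x = (\<beta>, s)" by (cases x)
  show ?case
    using Cons chord_split[of a b \<beta>] by (simp add: x run_def) (simp add: algebra_simps add_divide_distrib)
qed (simp add: run_def)

lemma cost_climb:
  "U_L > 0 \<Longrightarrow> total_cost U_L U_R \<mu>_L \<mu>_R (climb U_L a xs b) = (1 / U_L + \<mu>_L) * (b - a) + mass xs"
proof (induction xs arbitrary: a)
  case (Cons x xs)
  obtain \<beta> s where x: "x = (\<beta>, s)" by (cases x)
  have "(1 + \<mu>_L * U_L) * ((\<beta> - a) / U_L) = (1 / U_L + \<mu>_L) * (\<beta> - a)"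
    using Cons.prems by (simp add: field_simps)
  then show ?case
    using Cons.IH[of \<beta>] Cons.prems by (simp add: x total_cost_def) (simp add: algebra_simps diff_divide_distrib)
qed (simp add: total_cost_def field_simps)

lemma climb_nonneg:
  assumes "U > 0" "a \<le> b" "sorted (map fst xs)" "\<And>\<beta> s. (\<beta>, s) \<in> set xs \<Longrightarrow> a \<le> \<beta> \<and> \<beta> \<le> b \<and> 0 \<le> s"
    and "(X, d) \<in> set (climb U a xs b)"
  shows "d \<ge> 0"
  using assms
proof (induction xs arbitrary: a)
  case (Cons x xs)
  obtain \<beta> s where x: "x = (\<beta>, s)" by (cases x)
  have \<beta>: "a \<le> \<beta>" "\<beta> \<le> b" "0 \<le> s" using Cons.prems(4)[of \<beta> s] by (auto simp: x)
  from Cons.prems(5) consider "(X, d) = (L, (\<beta> - a) / U)" | "(X, d) = (S, s)" | "(X, d) \<in> set (climb U \<beta> xs b)"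
    by (auto simp: x)
  then show ?case
  proof cases
    case 3
    show ?thesis
    proof (rule Cons.IH[OF \<open>U > 0\<close> \<beta>(2) _ _ 3])
      show "sorted (map fst xs)" using Cons.prems(3) by (simp add: x)
      show "\<beta> \<le> \<beta>' \<and> \<beta>' \<le> b \<and> 0 \<le> s'" if "(\<beta>', s') \<in> set xs" for \<beta>' s'
        using Cons.prems(3) Cons.prems(4)[of \<beta>' s'] that by (force simp: x)
    qed
  qed (use \<beta> \<open>U > 0\<close> in auto)
qed auto

lemma route_nonneg:
  assumes "U_L > 0" "U_R > 0" "lo \<le> hi" "feasible K W lo hi a b xs" "sorted (map fst xs)"
    and "(X, d) \<in> set (route U_L U_R lo hi a b xs)"
  shows "d \<ge> 0"
  using assms climb_nonneg[of U_L a b xs X d] by (fastforce simp: route_def feasible_def)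

text \<open>Headings in \<open>[a, lo]\<close> and \<open>[hi, b]\<close> are swept once by an
  \<open>R\<close> arc and once by the \<open>L\<close> arcs, hence the weight
  \<open>1 / U_L + 1 / U_R\<close>; those in \<open>[lo, hi]\<close> are swept only by
  \<open>L\<close> arcs.\<close>

lemma run_route:
  assumes "U_L > 0" "U_R > 0" "feasible (1 / U_L + 1 / U_R) W lo hi a b xs"
  shows "run U_L U_R (route U_L U_R lo hi a b xs) (z, lo) =
    (z + complex_of_real (1 / U_L) * chord lo hi + W, hi)"
proof -
  have "chord a b = chord a lo + chord lo hi + chord hi b"
    using chord_split[of a b lo] chord_split[of lo b hi] by simp
  moreover have "W = complex_of_real (1 / U_L + 1 / U_R) * (chord a lo + chord hi b) + atoms xs"
    using assms by (simp add: feasible_def)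
  moreover have "run U_L U_R (route U_L U_R lo hi a b xs) (z, lo) =
    (z + complex_of_real (1 / U_R) * chord a lo + complex_of_real (1 / U_L) * chord a b + atoms xs
      + complex_of_real (1 / U_R) * chord hi b, hi)"
    using run_climb[of U_L U_R a xs b] assms(1,2) by (simp add: route_def run_def)
  ultimately show ?thesis by (simp add: algebra_simps)
qed

lemma cost_route:
  assumes "U_L > 0" "U_R > 0"
  shows "total_cost U_L U_R \<mu>_L \<mu>_R (route U_L U_R lo hi a b xs) =
    (1 / U_L + \<mu>_L) * (hi - lo) + excess (1 / U_L + 1 / U_R) (\<mu>_L + \<mu>_R) lo hi a b xs"
  using cost_climb[of U_L U_R \<mu>_L \<mu>_R a xs b] assms
  by (simp add: route_def total_cost_def excess_def) (simp add: field_simps)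

lemma run_filter: "run U_L U_R (filter (\<lambda>(X, d). d \<noteq> 0) xs) c = run U_L U_R xs c"
  by (induction xs arbitrary: c) (auto simp: run_def advance_zero)

lemma cost_filter:
  "total_cost U_L U_R \<mu>_L \<mu>_R (filter (\<lambda>(X, d). d \<noteq> 0) xs) = total_cost U_L U_R \<mu>_L \<mu>_R xs"
proof -
  have "segment_cost U_L U_R \<mu>_L \<mu>_R (X, 0) = 0" for X by (cases X) auto
  then show ?thesis by (induction xs) (auto simp: total_cost_def)
qed

lemma realises_nonneg:
  assumes "U_L > 0" "U_R > 0" "\<And>X d. (X, d) \<in> set xs \<Longrightarrow> d \<ge> 0"
  shows "\<exists>p. realises U_L U_R \<mu>_L \<mu>_R (filter (\<lambda>(X, d). d \<noteq> 0) xs) c p"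
  using assms by (intro realises_exists) (auto simp: order_less_le)

text \<open>\<open>climb_nonneg\<close> asks for sorted headings, while end point and mass do not
  depend on the order of the list.\<close>

lemma feasible_sort:
  assumes "feasible K W lo hi a b xs"
  shows "feasible K W lo hi a b (sort_key fst xs)" "mass (sort_key fst xs) = mass xs"
proof -
  have "atoms (sort_key fst xs) = atoms xs" "mass (sort_key fst xs) = mass xs"
    by (simp_all add: atoms_def mass_def flip: sum_mset_sum_list)
  then show "feasible K W lo hi a b (sort_key fst xs)" "mass (sort_key fst xs) = mass xs"
    using assms by (simp_all add: feasible_def)
qed

lemma of_type_realises:
  assumes "realises U_L U_R \<mu>_L \<mu>_R xs c p" "w = map fst xs"
  shows "w \<noteq> [] \<Longrightarrow> distinct_adj w \<Longrightarrow> of_type U_L U_R p w" "w = [] \<Longrightarrow> of_type U_L U_R p [S]"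
proof -
  from assms(1) obtain \<tau> :: "nat \<Rightarrow> real" where \<tau>: "\<tau> 0 = 0" "\<tau> (length xs) = final_time p"
    "\<forall>j < length xs. \<tau> j < \<tau> (Suc j) \<and> is_segment_on U_L U_R p (fst (xs ! j)) (\<tau> j) (\<tau> (Suc j))"
    unfolding realises_def by blast
  show "of_type U_L U_R p w" if "w \<noteq> []" "distinct_adj w"
    unfolding of_type_def using \<tau> that assms(2) by (intro disjI1 conjI exI[of _ \<tau>]) auto
  show "of_type U_L U_R p [S]" if "w = []"
    unfolding of_type_def using \<tau> that assms(2) by (intro disjI2) auto
qed

text \<open>A Farkas argument in the plane. If \<open>w\<close> points in a direction of
  \<open>[a, b]\<close>, that direction alone does, and its unit vector as functional bounds the
  length by \<open>m\<close>. Otherwise a functional with c = 0 would separate \<open>w\<close>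
  unless the range is wider than pi; then \<open>w\<close> lies in the sector between
  \<open>b\<close> and the next turn of \<open>a\<close>, hence is a positive combination of these
  two directions.\<close>

lemma two_directions_suffice:
  fixes a b m :: real and w :: complex
  assumes "a \<le> b"
    and dual: "\<And>n\<^sub>1 n\<^sub>2 c. c \<ge> 0 \<Longrightarrow> (\<And>\<beta>. \<beta> \<in> {a..b} \<Longrightarrow> n\<^sub>1 * cos \<beta> + n\<^sub>2 * sin \<beta> \<le> c) \<Longrightarrow>
      n\<^sub>1 * Re w + n\<^sub>2 * Im w \<le> c * m"
  obtains \<beta> s where "\<beta> \<in> {a..b}" "0 \<le> s" "s \<le> m" "w = complex_of_real s * cis \<beta>"
  | s\<^sub>1 s\<^sub>2 where "s\<^sub>1 > 0" "s\<^sub>2 > 0" "s\<^sub>1 + s\<^sub>2 \<le> m" "a < b"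
      "w = complex_of_real s\<^sub>1 * cis a + complex_of_real s\<^sub>2 * cis b"
proof (cases "w = 0")
  case True
  have "0 \<le> m" using dual[of 1 0 0] by simp
  with True \<open>a \<le> b\<close> show ?thesis by (intro that(1)[of a 0]) auto
next
  case False
  define r where "r = cmod w"
  have r: "r > 0" using False by (simp add: r_def)
  \<comment> \<open>The representative of \<open>Arg w\<close> in
    \<open>[a, a + 2 * pi)\<close>.\<close>
  define \<gamma> where "\<gamma> = a + (Arg w - a) rmod (2 * pi)"
  have "[\<gamma> = a + (Arg w - a)] (rmod (2 * pi))"
    unfolding \<gamma>_def by (simp only: rcong_add_left_cancel rcong_rmod_left rcong_refl)
  then have "cis \<gamma> = cis (Arg w)" by (simp add: cis_eq_iff)
  then have w: "w = complex_of_real r * cis \<gamma>"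
    using rcis_cmod_Arg[of w] by (simp add: rcis_def r_def)
  have \<gamma>: "a \<le> \<gamma>" "\<gamma> < a + 2 * pi"
    using rmod_nonneg[of "2 * pi" "Arg w - a"] rmod_less[of "2 * pi" "Arg w - a"]
    by (auto simp: \<gamma>_def)
  have dual': "t * (r * cos (\<phi> - \<gamma>)) \<le> c * m"
    if "c \<ge> 0" "\<And>\<beta>. \<beta> \<in> {a..b} \<Longrightarrow> t * cos (\<phi> - \<beta>) \<le> c" for t \<phi> c
    using dual[of c "t * cos \<phi>" "t * sin \<phi>"] that by (simp add: w cos_diff algebra_simps)
  have "r \<le> m" using dual'[of 1 1 \<gamma>] by simp
  show ?thesis
  proof (cases "\<gamma> \<le> b")
    case True
    then show ?thesis using \<open>r \<le> m\<close> r \<gamma> w by (intro that(1)[of \<gamma> r]) auto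
  next
    case b\<gamma>: False
    have wide: "b - a > pi"
    \<comment> \<open>For width at most pi the separating functional is normal to
      \<open>cis b\<close> or to \<open>cis a\<close>, or opposite to the only direction if
      \<open>a = b\<close>. It is nonpositive on the range and positive on \<open>w\<close>.\<close>
    proof (rule ccontr)
      assume narrow: "\<not> pi < b - a"
      consider "\<gamma> < b + pi" | "a + pi < \<gamma>" | "a = b" "\<gamma> = a + pi"
        using \<open>a \<le> b\<close> by linarith
      then show False
      proof cases
        case 1
        have "1 * (r * cos (b + pi / 2 - \<gamma>)) \<le> 0 * m"
        proof (rule dual')
          fix \<beta> assume "\<beta> \<in> {a..b}"
          then have "0 \<le> sin (b - \<beta>)" using narrow by (intro sin_ge_zero) auto
          moreover have "cos (b + pi / 2 - \<beta>) = - sin (b - \<beta>)"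
            using minus_sin_cos_eq[of "b - \<beta>"] by (simp add: algebra_simps)
          ultimately show "1 * cos (b + pi / 2 - \<beta>) \<le> 0" by simp
        qed simp
        moreover have "cos (b + pi / 2 - \<gamma>) = sin (\<gamma> - b)"
          using minus_sin_cos_eq[of "b - \<gamma>"] sin_minus[of "b - \<gamma>"] by (simp add: algebra_simps)
        moreover have "sin (\<gamma> - b) > 0" using 1 b\<gamma> by (intro sin_gt_zero) auto
        ultimately show False using r by (simp add: mult_le_0_iff)
      next
        case 2
        have "1 * (r * cos (pi / 2 - (a - \<gamma>))) \<le> 0 * m" if "\<And>\<beta>. \<beta> \<in> {a..b} \<Longrightarrow> cos (pi / 2 - (a - \<beta>)) \<le> 0"
          using dual'[of 0 1 "a - pi / 2"] that cos_minus[of "pi / 2 - (a - \<gamma>)"] cos_minus[of "pi / 2 - (a - \<beta>)" for \<beta>]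
          by (simp add: algebra_simps)
        moreover have "cos (pi / 2 - (a - \<beta>)) \<le> 0" if "\<beta> \<in> {a..b}" for \<beta>
        proof -
          have "0 \<le> sin (\<beta> - a)" using narrow that by (intro sin_ge_zero) auto
          then show ?thesis using sin_minus[of "a - \<beta>"] sin_cos_eq[of "a - \<beta>"] by simp
        qed
        moreover have "sin (\<gamma> - a) < 0" using 2 \<gamma> by (intro sin_lt_zero) auto
        then have "cos (pi / 2 - (a - \<gamma>)) > 0"
          using sin_minus[of "a - \<gamma>"] sin_cos_eq[of "a - \<gamma>"] by simp
        ultimately show False using r by (simp add: mult_le_0_iff)
      next
        case 3
        have "1 * (r * cos (a + pi - \<gamma>)) \<le> 0 * m"
          using 3 by (intro dual') auto
        then show False using r 3 by simp
      qed
    qed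
    define D where "D = b - a"
    have D: "pi < D" "D < 2 * pi" using wide b\<gamma> \<gamma> by (auto simp: D_def)
    have sD: "sin D < 0" using D by (intro sin_lt_zero) auto
    have cD: "cos (D / 2) < 0"
    proof -
      have "cos (pi / 2) > cos (D / 2)" using D by (intro cos_monotone_0_pi) auto
      then show ?thesis by simp
    qed
    \<comment> \<open>Cramer's rule for \<open>w\<close> in the directions \<open>a\<close> and
      \<open>b\<close>.\<close>
    define s\<^sub>1 s\<^sub>2 where "s\<^sub>1 = r * sin (\<gamma> - b) / - sin D" and "s\<^sub>2 = r * sin (\<gamma> - a) / sin D"
    have "sin (\<gamma> - b) > 0" using b\<gamma> \<gamma> wide by (intro sin_gt_zero) auto
    then have s1: "s\<^sub>1 > 0" using sD r by (simp add: s\<^sub>1_def divide_pos_neg)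
    have "sin (\<gamma> - a) < 0" using b\<gamma> \<gamma> wide by (intro sin_lt_zero) auto
    then have s2: "s\<^sub>2 > 0" using sD r by (simp add: s\<^sub>2_def zero_less_divide_iff mult_pos_neg mult_less_0_iff)
    have id: "sin (b - a) * cos \<gamma> = sin (\<gamma> - a) * cos b - sin (\<gamma> - b) * cos a"
      "sin (b - a) * sin \<gamma> = sin (\<gamma> - a) * sin b - sin (\<gamma> - b) * sin a"
      by (simp_all add: sin_diff algebra_simps)
    have w2: "w = complex_of_real s\<^sub>1 * cis a + complex_of_real s\<^sub>2 * cis b"
    proof -
      have "s\<^sub>1 * cos a + s\<^sub>2 * cos b = r * (sin D * cos \<gamma>) / sin D"
        using sD unfolding D_def id(1) s\<^sub>1_def s\<^sub>2_def by (simp add: field_simps)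
      moreover have "s\<^sub>1 * sin a + s\<^sub>2 * sin b = r * (sin D * sin \<gamma>) / sin D"
        using sD unfolding D_def id(2) s\<^sub>1_def s\<^sub>2_def by (simp add: field_simps)
      ultimately show ?thesis using sD by (simp add: complex_eq_iff w)
    qed
    \<comment> \<open>Because \<open>cos (D / 2) < 0\<close>, this functional is 1 at
      \<open>a\<close> and at \<open>b\<close> and at most 1 in between, so its value on
      \<open>w\<close> is \<open>s\<^sub>1 + s\<^sub>2\<close>.\<close>
    define t \<phi> where "t = 1 / cos (D / 2)" and "\<phi> = (a + b) / 2"
    have "t * cos \<phi> * Re w + t * sin \<phi> * Im w \<le> 1 * m"
    proof (rule dual)
      fix \<beta> assume \<beta>: "\<beta> \<in> {a..b}"
      have "\<bar>\<phi> - \<beta>\<bar> \<le> D / 2" using \<beta> by (auto simp: \<phi>_def D_def abs_le_iff field_simps)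
      then have "cos (D / 2) \<le> cos \<bar>\<phi> - \<beta>\<bar>" using D by (intro cos_monotone_0_pi_le) auto
      then have "t * cos (\<phi> - \<beta>) \<le> 1" using cD by (simp add: t_def field_simps)
      then show "t * cos \<phi> * cos \<beta> + t * sin \<phi> * sin \<beta> \<le> 1" by (simp add: cos_diff algebra_simps)
    qed simp
    moreover have "t * cos \<phi> * Re w + t * sin \<phi> * Im w = t * (s\<^sub>1 * cos (\<phi> - a) + s\<^sub>2 * cos (\<phi> - b))"
      by (simp add: w2 cos_diff algebra_simps)
    moreover have "\<phi> - a = D / 2" "\<phi> - b = - (D / 2)" by (simp_all add: \<phi>_def D_def field_simps)
    ultimately have "t * (s\<^sub>1 * cos (D / 2) + s\<^sub>2 * cos (D / 2)) \<le> m" by simp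
    then have "s\<^sub>1 + s\<^sub>2 \<le> m" using cD by (simp add: t_def distrib_right[symmetric])
    moreover have "a < b" using wide pi_gt_zero by linarith
    ultimately show ?thesis using s1 s2 w2 by (intro that(2)[of s\<^sub>1 s\<^sub>2]) auto
  qed
qed

section \<open>Target words, and paths whose final heading is at least the initial one\<close>

definition words :: "segment list set" where
  "words = {[S], [L], [R],
         [S,L], [S,R], [L,S], [R,S], [L,R], [R,L],
         [L,S,L], [L,S,R], [R,S,L], [R,S,R], [S,L,S], [S,R,S],
         [L,S,R,S], [S,R,S,L], [R,S,L,S], [S,L,S,R],
         [L,S,R,S,L], [R,S,L,S,R]}"

lemma admissible_realises:
  assumes "admissible U_L U_R c\<^sub>i c\<^sub>f p" "realises U_L U_R \<mu>_L \<mu>_R xs c q"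
    "c = (Complex (pos_x p 0) (pos_y p 0), heading p 0)" "run U_L U_R xs c = end_state p"
  shows "admissible U_L U_R c\<^sub>i c\<^sub>f q"
  using assms by (auto simp: admissible_def realises_def at_configuration_def end_state_def)

definition word_of :: "(segment \<times> real) list \<Rightarrow> segment list" where
  "word_of xs = map fst (filter (\<lambda>(X, d). d \<noteq> 0) xs)"

text \<open>These are the five shapes to which \<open>increasing_case\<close> reduces. The empty
  word occurs when all lengths vanish and is replaced there by the degenerate
  \<open>[S]\<close>.\<close>

lemma route_words:
  fixes U_L U_R a b s s\<^sub>1 s\<^sub>2 \<beta> :: real
  assumes "U_L > 0" "U_R > 0"
  defines "good \<equiv> (\<lambda>w. w = [] \<or> distinct_adj w \<and> w \<in> words)"
  shows "good (word_of (route U_L U_R lo hi lo hi []))"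
    and "s > 0 \<Longrightarrow> good (word_of (route U_L U_R lo hi lo hi [(\<beta>, s)]))"
    and "a < lo \<Longrightarrow> lo \<le> hi \<Longrightarrow> good (word_of (route U_L U_R lo hi a hi [(a, s)]))"
    and "hi < b \<Longrightarrow> lo \<le> hi \<Longrightarrow> good (word_of (route U_L U_R lo hi lo b [(b, s)]))"
    and "a < b \<Longrightarrow> s\<^sub>1 > 0 \<Longrightarrow> s\<^sub>2 > 0 \<Longrightarrow> good (word_of (route U_L U_R lo hi a b [(a, s\<^sub>1), (b, s\<^sub>2)]))"
proof -
  have U: "U_L \<noteq> 0" "U_R \<noteq> 0" using assms by auto
  show "good (word_of (route U_L U_R lo hi lo hi []))"
    by (cases "lo = hi"; simp add: good_def words_def word_of_def route_def U)
  show "good (word_of (route U_L U_R lo hi lo hi [(\<beta>, s)]))" if "s > 0"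
    using that by (cases "\<beta> = lo"; cases "\<beta> = hi"; simp add: good_def words_def word_of_def route_def U)
  show "good (word_of (route U_L U_R lo hi a hi [(a, s)]))" if "a < lo" "lo \<le> hi"
    using that by (cases "s = 0"; simp add: good_def words_def word_of_def route_def U)
  show "good (word_of (route U_L U_R lo hi lo b [(b, s)]))" if "hi < b" "lo \<le> hi"
    using that by (cases "s = 0"; simp add: good_def words_def word_of_def route_def U)
  show "good (word_of (route U_L U_R lo hi a b [(a, s\<^sub>1), (b, s\<^sub>2)]))" if "a < b" "s\<^sub>1 > 0" "s\<^sub>2 > 0"
    using that by (cases "a = lo"; cases "b = hi"; simp add: good_def words_def word_of_def route_def U)
qed

text \<open>Feasible lists give admissible paths, and \<open>calibration\<close> with
  \<open>two_directions_suffice\<close> gives back a feasible list costing no more than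
  \<open>p\<close>. So both problems have the same optimal value, and minimal lists turn into
  optimal paths.\<close>

lemma increasing_case:
  assumes U: "U_L > 0" "U_R > 0" and \<mu>: "\<mu>_L \<ge> 0" "\<mu>_R \<ge> 0" "\<mu>_L + \<mu>_R > 0"
    and opt: "optimal U_L U_R \<mu>_L \<mu>_R c\<^sub>i c\<^sub>f p"
    and le: "heading p 0 \<le> heading p (final_time p)"
  shows "\<exists>q w. optimal U_L U_R \<mu>_L \<mu>_R c\<^sub>i c\<^sub>f q \<and> of_type U_L U_R q w \<and> w \<in> words"
proof -
  define T lo hi K M where "T = final_time p" and "lo = heading p 0" and "hi = heading p T"
    and "K = 1 / U_L + 1 / U_R" and "M = \<mu>_L + \<mu>_R"
  define z where "z = Complex (pos_x p 0) (pos_y p 0)"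
  define base where "base = (1 / U_L + \<mu>_L) * (hi - lo)"
  define W where "W = Complex (pos_x p T - pos_x p 0) (pos_y p T - pos_y p 0) - complex_of_real (1 / U_L) * chord lo hi"
  have adm: "admissible U_L U_R c\<^sub>i c\<^sub>f p"
    and best: "\<And>q. admissible U_L U_R c\<^sub>i c\<^sub>f q \<Longrightarrow> cost \<mu>_L \<mu>_R p \<le> cost \<mu>_L \<mu>_R q"
    using opt by (auto simp: optimal_def)
  have T: "T \<ge> 0" "controls_in U_L U_R p" "satisfies_dynamics p"
    using adm by (auto simp: admissible_def T_def)
  have K: "K > 0" and M: "M > 0" and lohi: "lo \<le> hi"
    using U \<mu> le by (auto simp: K_def M_def lo_def hi_def T_def add_pos_pos)
  have target: "(z + complex_of_real (1 / U_L) * chord lo hi + W, hi) = end_state p"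
    by (simp add: z_def W_def end_state_def T_def hi_def complex_eq_iff)
  have run: "run U_L U_R (route U_L U_R lo hi a b ys) (z, lo) = end_state p"
    if "feasible K W lo hi a b ys" for a b ys
    using run_route[OF U that[unfolded K_def], of z] target by simp
  \<comment> \<open>Each feasible list, once sorted, is run as a path between the same
    configurations, so \<open>p\<close> costs no more.\<close>
  have lower: "cost \<mu>_L \<mu>_R p \<le> base + excess K M lo hi a b ys" if "feasible K W lo hi a b ys" for a b ys
  proof -
    note sorted = feasible_sort[OF that]
    define xs where "xs = route U_L U_R lo hi a b (sort_key fst ys)"
    have "d \<ge> 0" if "(X, d) \<in> set xs" for X d
      using route_nonneg[OF U lohi sorted(1)] that unfolding xs_def by simp
    then obtain q where q: "realises U_L U_R \<mu>_L \<mu>_R (filter (\<lambda>(X, d). d \<noteq> 0) xs) (z, lo) q"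
      using realises_nonneg[OF U] by blast
    have "admissible U_L U_R c\<^sub>i c\<^sub>f q"
      by (rule admissible_realises[OF adm q]) (simp_all add: z_def lo_def run_filter xs_def run[OF sorted(1), unfolded z_def lo_def])
    then have "cost \<mu>_L \<mu>_R p \<le> cost \<mu>_L \<mu>_R q" by (rule best)
    also have "\<dots> = base + excess K M lo hi a b (sort_key fst ys)"
      using q by (simp add: realises_def cost_filter xs_def cost_route[OF U] base_def K_def M_def)
    finally show ?thesis by (simp add: excess_def sorted(2))
  qed
  have cont: "continuous_on {0..T} (heading p)"
    using heading_continuous[OF U T(1)[unfolded T_def] T(2,3)] by (simp add: T_def)
  obtain ta where ta: "ta \<in> {0..T}" "\<And>t. t \<in> {0..T} \<Longrightarrow> heading p ta \<le> heading p t"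
    using continuous_attains_inf[OF compact_Icc _ cont] T(1) by auto
  obtain tb where tb: "tb \<in> {0..T}" "\<And>t. t \<in> {0..T} \<Longrightarrow> heading p t \<le> heading p tb"
    using continuous_attains_sup[OF compact_Icc _ cont] T(1) by auto
  define a b where "a = heading p ta" and "b = heading p tb"
  have ab: "a \<le> lo" "hi \<le> b" using ta tb T(1) by (auto simp: a_def b_def lo_def hi_def)
  define w where "w = W - complex_of_real K * (chord a lo + chord hi b)"
  define m where "m = cost \<mu>_L \<mu>_R p - base - (K + M) * ((lo - a) + (b - hi))"
  have dual: "n\<^sub>1 * Re w + n\<^sub>2 * Im w \<le> c * m"
    if "c \<ge> 0" "\<And>\<beta>. \<beta> \<in> {a..b} \<Longrightarrow> n\<^sub>1 * cos \<beta> + n\<^sub>2 * sin \<beta> \<le> c" for n\<^sub>1 n\<^sub>2 c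
    using calibration[OF U T(1)[unfolded T_def] T(2,3) \<mu>(1,2), where ta=ta and tb=tb and a=a and b=b] ta tb le that
    unfolding w_def m_def W_def K_def M_def lo_def hi_def T_def base_def a_def b_def by simp
  \<comment> \<open>A list carrying the residual displacement \<open>w\<close> with mass at most
    \<open>m\<close> reaches the bound \<open>lower\<close>, which makes it minimal.\<close>
  have direct: "minimal K M W lo hi a b ys \<and> base + excess K M lo hi a b ys \<le> cost \<mu>_L \<mu>_R p"
    if "atoms ys = w" "mass ys \<le> m" "\<forall>(\<beta>, s) \<in> set ys. \<beta> \<in> {a..b} \<and> 0 \<le> s" for ys
  proof -
    have "feasible K W lo hi a b ys"
      using that ab by (auto simp: feasible_def w_def)
    moreover have "base + excess K M lo hi a b ys \<le> cost \<mu>_L \<mu>_R p"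
      using that(2) by (simp add: excess_def m_def)
    ultimately show ?thesis using lower unfolding minimal_def by fastforce
  qed
  \<comment> \<open>The list may use another range than the headings of \<open>p\<close>. The list
    in \<open>low\<close> is no dearer than \<open>p\<close>, and minimality transfers this to the
    given one.\<close>
  have finish: ?thesis
    if minimal: "minimal K M W lo hi a' b' ys" and ys: "sorted (map fst ys)"
      and v: "v = word_of (route U_L U_R lo hi a' b' ys)"
      "v = [] \<or> distinct_adj v \<and> v \<in> words"
      and low: "\<exists>a b ys. feasible K W lo hi a b ys \<and> base + excess K M lo hi a b ys \<le> cost \<mu>_L \<mu>_R p"
    for a' b' ys v
  proof -
    have feas: "feasible K W lo hi a' b' ys" using minimal by (simp add: minimal_def)
    define xs where "xs = route U_L U_R lo hi a' b' ys"
    have "d \<ge> 0" if "(X, d) \<in> set xs" for X d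
      using route_nonneg[OF U lohi feas ys] that unfolding xs_def by simp
    then obtain q where q: "realises U_L U_R \<mu>_L \<mu>_R (filter (\<lambda>(X, d). d \<noteq> 0) xs) (z, lo) q"
      using realises_nonneg[OF U] by blast
    have "admissible U_L U_R c\<^sub>i c\<^sub>f q"
      by (rule admissible_realises[OF adm q])
        (simp_all add: z_def lo_def run_filter xs_def run[OF feas, unfolded z_def lo_def])
    moreover have "cost \<mu>_L \<mu>_R q = base + excess K M lo hi a' b' ys"
      using q by (simp add: realises_def cost_filter xs_def cost_route[OF U] base_def K_def M_def)
    then have "cost \<mu>_L \<mu>_R q \<le> cost \<mu>_L \<mu>_R p"
      using low minimal unfolding minimal_def by fastforce
    ultimately have "optimal U_L U_R \<mu>_L \<mu>_R c\<^sub>i c\<^sub>f q"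
      using best unfolding optimal_def by (meson order_trans)
    moreover have "of_type U_L U_R q (if v = [] then [S] else v)"
    proof (cases "v = []")
      case False
      then have "distinct_adj v" using v(2) by blast
      then show ?thesis
        using False of_type_realises(1)[OF q[unfolded xs_def] v(1)[unfolded word_of_def]] by simp
    qed (use of_type_realises(2)[OF q[unfolded xs_def] v(1)[unfolded word_of_def]] in simp)
    moreover have "(if v = [] then [S] else v) \<in> words"
      using v(2) by (auto simp: words_def)
    ultimately show ?thesis
      by blast
  qed
  have "a \<le> b" using ab lohi by simp
  then show ?thesis
  proof (rule two_directions_suffice[OF _ dual])
    fix \<beta> s
    assume *: "\<beta> \<in> {a..b}" "0 \<le> s" "s \<le> m" "w = complex_of_real s * cis \<beta>"
    have dir: "minimal K M W lo hi a b [(\<beta>, s)] \<and> base + excess K M lo hi a b [(\<beta>, s)] \<le> cost \<mu>_L \<mu>_R p"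
      using * by (intro direct) auto
    then have min: "minimal K M W lo hi a b [(\<beta>, s)]" by blast
    have low: "\<exists>a b ys. feasible K W lo hi a b ys \<and> base + excess K M lo hi a b ys \<le> cost \<mu>_L \<mu>_R p"
      using dir unfolding minimal_def by blast
    note words = route_words[OF U, where lo=lo and hi=hi]
    consider "a < lo" | "hi < b" | "a = lo" "b = hi" using ab by linarith
    then show ?thesis
    proof cases
      case 1
      from minimal_low_end[OF K M lohi min 1] have "minimal K M W lo hi a hi [(a, s)]" by auto
      from finish[OF this _ refl words(3)[OF 1 lohi] low] show ?thesis by simp
    next
      case 2
      from minimal_high_end[OF K M lohi min 2] have "minimal K M W lo hi lo b [(b, s)]" by auto
      from finish[OF this _ refl words(4)[OF 2 lohi] low] show ?thesis by simp
    next
      case 3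
      show ?thesis
      proof (cases "s = 0")
        case True
        have "minimal K M W lo hi lo hi []"
          using min True 3 by (intro minimal_eqI[OF min]) (auto simp: minimal_def feasible_def excess_def)
        from finish[OF this _ refl words(1) low] show ?thesis by simp
      next
        case False
        then have "s > 0" using *(2) by simp
        from finish[OF min[unfolded 3] _ refl words(2)[OF this] low] show ?thesis by simp
      qed
    qed
  next
    fix s\<^sub>1 s\<^sub>2
    assume *: "s\<^sub>1 > 0" "s\<^sub>2 > 0" "s\<^sub>1 + s\<^sub>2 \<le> m" "a < b"
      "w = complex_of_real s\<^sub>1 * cis a + complex_of_real s\<^sub>2 * cis b"
    have dir: "minimal K M W lo hi a b [(a, s\<^sub>1), (b, s\<^sub>2)] \<and>
        base + excess K M lo hi a b [(a, s\<^sub>1), (b, s\<^sub>2)] \<le> cost \<mu>_L \<mu>_R p"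
      using * by (intro direct) auto
    have low: "\<exists>a b ys. feasible K W lo hi a b ys \<and> base + excess K M lo hi a b ys \<le> cost \<mu>_L \<mu>_R p"
      using dir unfolding minimal_def by blast
    \<comment> \<open>Straight pieces at both ends of the range already give \<open>RSLSR\<close> up
      to empty outer arcs, so no reshaping is required.\<close>
    from finish[OF conjunct1[OF dir] _ refl route_words(5)[OF U *(4,1,2)] low] *(4) show ?thesis by simp
  qed
qed

subsection \<open>Reflection\<close>

definition reflect :: "path_data \<Rightarrow> path_data" where
  "reflect p = \<lparr>final_time = final_time p, control_L = control_R p, control_R = control_L p,
     pos_x = pos_x p, pos_y = (\<lambda>t. - pos_y p t), heading = (\<lambda>t. - heading p t)\<rparr>"

fun reflect_configuration :: "configuration \<Rightarrow> configuration" where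
  "reflect_configuration (x, y, \<alpha>) = (x, - y, - \<alpha>)"

fun reflect_segment :: "segment \<Rightarrow> segment" where
  "reflect_segment L = R" | "reflect_segment R = L" | "reflect_segment S = S"

lemma reflect_involution [simp]: "reflect (reflect p) = p"
  "reflect_configuration (reflect_configuration c) = c"
  by (cases p, simp add: reflect_def) (cases c, simp)

lemma admissible_reflect:
  assumes "admissible U_L U_R c\<^sub>i c\<^sub>f p"
  shows "admissible U_R U_L (reflect_configuration c\<^sub>i) (reflect_configuration c\<^sub>f) (reflect p)"
proof -
  have "satisfies_dynamics (reflect p)"
    unfolding satisfies_dynamics_def
  proof (intro ballI conjI)
    fix t assume "t \<in> {0..final_time (reflect p)}"
    then have D: "((\<lambda>s. cos (heading p s)) has_integral (pos_x p t - pos_x p 0)) {0..t}"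
        "((\<lambda>s. sin (heading p s)) has_integral (pos_y p t - pos_y p 0)) {0..t}"
        "((\<lambda>s. control_L p s - control_R p s) has_integral (heading p t - heading p 0)) {0..t}"
      using assms by (auto simp: admissible_def satisfies_dynamics_def reflect_def)
    from D(1) show "((\<lambda>s. cos (heading (reflect p) s)) has_integral
        (pos_x (reflect p) t - pos_x (reflect p) 0)) {0..t}"
      by (simp add: reflect_def)
    from has_integral_neg[OF D(2)] show "((\<lambda>s. sin (heading (reflect p) s)) has_integral
        (pos_y (reflect p) t - pos_y (reflect p) 0)) {0..t}"
      by (simp add: reflect_def)
    from has_integral_neg[OF D(3)] show "((\<lambda>s. control_L (reflect p) s - control_R (reflect p) s) has_integral
        (heading (reflect p) t - heading (reflect p) 0)) {0..t}"
      by (simp add: reflect_def)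
  qed
  moreover have "at_configuration (reflect p) t (reflect_configuration c)" if "at_configuration p t c" for t c
    using that by (cases c) (auto simp: at_configuration_def reflect_def)
  moreover have "final_time (reflect p) = final_time p" by (simp add: reflect_def)
  ultimately show ?thesis
    using assms by (auto simp: admissible_def controls_in_def reflect_def[of p])
qed

lemma cost_reflect: "cost \<mu>_R \<mu>_L (reflect p) = cost \<mu>_L \<mu>_R p"
  by (simp add: cost_def reflect_def add_ac)

lemma optimal_reflect:
  assumes "optimal U_L U_R \<mu>_L \<mu>_R c\<^sub>i c\<^sub>f p"
  shows "optimal U_R U_L \<mu>_R \<mu>_L (reflect_configuration c\<^sub>i) (reflect_configuration c\<^sub>f) (reflect p)"
  unfolding optimal_def
proof (intro conjI allI impI)
  show "admissible U_R U_L (reflect_configuration c\<^sub>i) (reflect_configuration c\<^sub>f) (reflect p)"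
    using assms by (intro admissible_reflect) (simp add: optimal_def)
  fix q assume "admissible U_R U_L (reflect_configuration c\<^sub>i) (reflect_configuration c\<^sub>f) q"
  from admissible_reflect[OF this] have "admissible U_L U_R c\<^sub>i c\<^sub>f (reflect q)" by simp
  then have "cost \<mu>_L \<mu>_R p \<le> cost \<mu>_L \<mu>_R (reflect q)"
    using assms by (simp add: optimal_def)
  then show "cost \<mu>_R \<mu>_L (reflect p) \<le> cost \<mu>_R \<mu>_L q"
    unfolding cost_reflect .
qed

lemma of_type_reflect:
  assumes "of_type U_L U_R p w"
  shows "of_type U_R U_L (reflect p) (map reflect_segment w)"
proof -
  have "inj_on reflect_segment A" for A
    by (rule inj_onI, rename_tac X Y, case_tac X; case_tac Y; simp)
  then have "distinct_adj (map reflect_segment w)" if "distinct_adj w"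
    using that by (simp add: distinct_adj_map_iff)
  note adj = this
  have seg: "is_segment_on U_R U_L (reflect p) (reflect_segment X) s t"
    if "is_segment_on U_L U_R p X s t" for X s t
    using that unfolding is_segment_on_def by eventually_elim (cases X; simp add: reflect_def)
  have time: "final_time (reflect p) = final_time p" by (simp add: reflect_def)
  from assms consider \<tau> :: "nat \<Rightarrow> real" where "w \<noteq> []" "distinct_adj w" "\<tau> 0 = 0" "\<tau> (length w) = final_time p"
      "\<And>j. j < length w \<Longrightarrow> \<tau> j < \<tau> (Suc j) \<and> is_segment_on U_L U_R p (w ! j) (\<tau> j) (\<tau> (Suc j))"
    | "final_time p = 0" "w = [S]"
    unfolding of_type_def by blast
  then show ?thesis
  proof cases
    case (1 \<tau>)
    then show ?thesis
      unfolding of_type_def using adj seg time by (intro disjI1 conjI exI[of _ \<tau>]) simp_all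
  qed (simp add: of_type_def time)
qed

lemma map_reflect_segment_words: "w \<in> words \<Longrightarrow> map reflect_segment w \<in> words"
  unfolding words_def by (elim insertE emptyE; simp)

theorem theorem16:
  fixes U_L U_R \<mu>_L \<mu>_R x_i y_i \<alpha>_i x_f y_f \<alpha>_f :: real
  assumes "U_L > 0" and "U_R > 0"
    and "\<mu>_L \<ge> 0" and "\<mu>_R \<ge> 0" and "\<mu>_L + \<mu>_R > 0"
    and "\<exists>p. optimal U_L U_R \<mu>_L \<mu>_R (x_i, y_i, \<alpha>_i) (x_f, y_f, \<alpha>_f) p"
  shows "\<exists>p w. optimal U_L U_R \<mu>_L \<mu>_R (x_i, y_i, \<alpha>_i) (x_f, y_f, \<alpha>_f) p \<and>
    of_type U_L U_R p w \<and>
    w \<in> {[S], [L], [R],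
         [S,L], [S,R], [L,S], [R,S], [L,R], [R,L],
         [L,S,L], [L,S,R], [R,S,L], [R,S,R], [S,L,S], [S,R,S],
         [L,S,R,S], [S,R,S,L], [R,S,L,S], [S,L,S,R],
         [L,S,R,S,L], [R,S,L,S,R]}"
proof -
  from assms(6) obtain p where p: "optimal U_L U_R \<mu>_L \<mu>_R (x_i, y_i, \<alpha>_i) (x_f, y_f, \<alpha>_f) p" ..
  have "\<exists>q w. optimal U_L U_R \<mu>_L \<mu>_R (x_i, y_i, \<alpha>_i) (x_f, y_f, \<alpha>_f) q \<and>
      of_type U_L U_R q w \<and> w \<in> words"
  proof (cases "heading p 0 \<le> heading p (final_time p)")
    case True
    show ?thesis by (rule increasing_case[OF assms(1-5) p True])
  next
    case False
    \<comment> \<open>Reflection makes the net heading change positive, and \<open>words\<close> is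
      closed under exchanging \<open>L\<close> and \<open>R\<close>.\<close>
    have "heading (reflect p) 0 \<le> heading (reflect p) (final_time (reflect p))"
      using False by (simp add: reflect_def)
    moreover have "\<mu>_R + \<mu>_L > 0" using assms(5) by simp
    ultimately obtain q w where q: "optimal U_R U_L \<mu>_R \<mu>_L (reflect_configuration (x_i, y_i, \<alpha>_i))
        (reflect_configuration (x_f, y_f, \<alpha>_f)) q" "of_type U_R U_L q w" "w \<in> words"
      using increasing_case[OF assms(2,1,4,3) _ optimal_reflect[OF p]] by blast
    from optimal_reflect[OF q(1)] of_type_reflect[OF q(2)] map_reflect_segment_words[OF q(3)]
    show ?thesis unfolding reflect_involution by blast
  qed
  then show ?thesis unfolding words_def .
qed

end
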